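(* Let $G$ be a simple, finite, connected, undirected partial 2-tree equipped with an edge weight function $w: E(G)\to \mathbb{N}$ and a total order on $V(G)$. Then the set of lex short cycles of $G$ is a minimum cycle basis of $G$.
   Context: A 2-tree is defined inductively: $K_3$ is a 2-tree; if $G'$ is a 2-tree and $G$ is obtained from $G'$ by adding a new vertex $v$ whose neighbourhood in $G$ induces an edge of $G'$, then $G$ is a 2-tree. A partial 2-tree is a subgraph of a 2-tree. For a path $P$, $w(P)=\sum_{e\in E(P)} w(e)$. Given the total order on $V(G)$, a path $P$ between distinct vertices $u,v$ is the lex shortest path if for every other $u$–$v$ path $P'$ exactly one of: (1) $w(P')>w(P)$; (2) $w(P')=w(P)$ and $|E(P')|>|E(P)|$; (3) $w(P')=w(P)$, $|E(P')|=|E(P)|$ and $\min(V(P')\setminus V(P))>\min(V(P)\setminus V(P'))$. It is unique and denoted $lsp(u,v)$. A cycle $C$ is lex short if for every $x,y\in V(C)$, $lsp(x,y)\subseteq C$. The cycle space is the $\mathbb{F}_2$-span of incidence vectors (indexed by $E(G)$) of cycles; a cycle basis is a minimum-size set of cycles whose incidence vectors span the cycle space; the weight of a cycle is the sum of its edge weights; a minimum cycle basis is a cycle basis of minimum total weight. *)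

theory Defs
  imports Complex_Main "HOL-Library.Z2" "HOL-Library.Function_Algebras"
begin

record 'a ugraph =
  verts :: "'a set"
  edges :: "'a set set"

definition simple_graph :: "'a ugraph \<Rightarrow> bool" where
  "simple_graph G \<longleftrightarrow> (\<forall>e\<in>edges G. e \<subseteq> verts G \<and> card e = 2)"

definition subgraph :: "'a ugraph \<Rightarrow> 'a ugraph \<Rightarrow> bool" where
  "subgraph H G \<longleftrightarrow> verts H \<subseteq> verts G \<and> edges H \<subseteq> edges G"

inductive two_tree :: "'a ugraph \<Rightarrow> bool" where
  K3: "card V = 3 \<Longrightarrow> two_tree \<lparr>verts = V, edges = {e. e \<subseteq> V \<and> card e = 2}\<rparr>"
| add_vertex: "two_tree G \<Longrightarrow> {x, y} \<in> edges G \<Longrightarrow> v \<notin> verts G \<Longrightarrow>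
    two_tree \<lparr>verts = insert v (verts G), edges = edges G \<union> {{v, x}, {v, y}}\<rparr>"

definition partial_two_tree :: "'a ugraph \<Rightarrow> bool" where
  "partial_two_tree G \<longleftrightarrow> simple_graph G \<and> (\<exists>H. two_tree H \<and> subgraph G H)"

definition walk_graph :: "'a list \<Rightarrow> 'a ugraph" where
  "walk_graph p = \<lparr>verts = set p, edges = {{p ! i, p ! Suc i} | i. Suc i < length p}\<rparr>"

definition is_path :: "'a ugraph \<Rightarrow> 'a \<Rightarrow> 'a \<Rightarrow> 'a ugraph \<Rightarrow> bool" where
  "is_path G u v P \<longleftrightarrow>
     (\<exists>p. p \<noteq> [] \<and> hd p = u \<and> last p = v \<and> distinct p \<and> P = walk_graph p) \<and> subgraph P G"

definition is_cycle :: "'a ugraph \<Rightarrow> 'a ugraph \<Rightarrow> bool" where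
  "is_cycle G C \<longleftrightarrow>
     (\<exists>p. length p \<ge> 3 \<and> distinct p \<and> C = walk_graph (p @ [hd p])) \<and> subgraph C G"

definition connected_graph :: "'a ugraph \<Rightarrow> bool" where
  "connected_graph G \<longleftrightarrow> (\<forall>u\<in>verts G. \<forall>v\<in>verts G. \<exists>P. is_path G u v P)"

definition weight :: "('a set \<Rightarrow> nat) \<Rightarrow> 'a ugraph \<Rightarrow> nat" where
  "weight w H = (\<Sum>e\<in>edges H. w e)"

text \<open>A pair \<open>(x, y) \<in> r\<close> means that \<open>x\<close> is at most \<open>y\<close> in the order \<open>r\<close>.\<close>

definition min_wrt :: "'a rel \<Rightarrow> 'a set \<Rightarrow> 'a" where
  "min_wrt r A = (THE m. m \<in> A \<and> (\<forall>x\<in>A. (m, x) \<in> r))"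

definition less_wrt :: "'a rel \<Rightarrow> 'a \<Rightarrow> 'a \<Rightarrow> bool" where
  "less_wrt r x y \<longleftrightarrow> (x, y) \<in> r \<and> x \<noteq> y"

text \<open>
  In the third alternative both paths have the same number of edges, hence of vertices, so the two
  vertex differences are both empty or both nonempty. If both are empty, the two minima are the
  same (unspecified) element and the strict comparison fails.
\<close>

definition is_lsp ::
  "'a ugraph \<Rightarrow> ('a set \<Rightarrow> nat) \<Rightarrow> 'a rel \<Rightarrow> 'a \<Rightarrow> 'a \<Rightarrow> 'a ugraph \<Rightarrow> bool" where
  "is_lsp G w r u v P \<longleftrightarrow> is_path G u v P \<and>
     (\<forall>P'. is_path G u v P' \<and> P' \<noteq> P \<longrightarrow>
        weight w P' > weight w P
      \<or> (weight w P' = weight w P \<and> card (edges P') > card (edges P))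
      \<or> (weight w P' = weight w P \<and> card (edges P') = card (edges P) \<and>
          less_wrt r (min_wrt r (verts P - verts P')) (min_wrt r (verts P' - verts P))))"

definition lsp :: "'a ugraph \<Rightarrow> ('a set \<Rightarrow> nat) \<Rightarrow> 'a rel \<Rightarrow> 'a \<Rightarrow> 'a \<Rightarrow> 'a ugraph" where
  "lsp G w r u v = (THE P. is_lsp G w r u v P)"

definition lex_short_cycle ::
  "'a ugraph \<Rightarrow> ('a set \<Rightarrow> nat) \<Rightarrow> 'a rel \<Rightarrow> 'a ugraph \<Rightarrow> bool" where
  "lex_short_cycle G w r C \<longleftrightarrow> is_cycle G C \<and>
     (\<forall>x\<in>verts C. \<forall>y\<in>verts C. x \<noteq> y \<longrightarrow> subgraph (lsp G w r x y) C)"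

text \<open>
  Vectors over the two-element field are functions defined on all sets of vertices. Incidence
  vectors of cycles of \<open>G\<close>, and hence all elements of their span, vanish outside \<open>edges G\<close>.
\<close>

definition incidence_vector :: "'a ugraph \<Rightarrow> 'a set \<Rightarrow> bit" where
  "incidence_vector C = (\<lambda>e. if e \<in> edges C then 1 else 0)"

definition scale_F2 :: "bit \<Rightarrow> ('a set \<Rightarrow> bit) \<Rightarrow> ('a set \<Rightarrow> bit)" where
  "scale_F2 c f = (\<lambda>e. c * f e)"

lemma vector_space_scale_F2: "vector_space scale_F2"
  by unfold_locales (auto simp: scale_F2_def fun_eq_iff algebra_simps)

definition span_F2 :: "('a set \<Rightarrow> bit) set \<Rightarrow> ('a set \<Rightarrow> bit) set" where
  "span_F2 = module.span scale_F2"

definition cycle_space :: "'a ugraph \<Rightarrow> ('a set \<Rightarrow> bit) set" where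
  "cycle_space G = span_F2 (incidence_vector ` {C. is_cycle G C})"

definition spanning_cycles :: "'a ugraph \<Rightarrow> 'a ugraph set \<Rightarrow> bool" where
  "spanning_cycles G B \<longleftrightarrow>
     B \<subseteq> {C. is_cycle G C} \<and> span_F2 (incidence_vector ` B) = cycle_space G"

definition cycle_basis :: "'a ugraph \<Rightarrow> 'a ugraph set \<Rightarrow> bool" where
  "cycle_basis G B \<longleftrightarrow>
     spanning_cycles G B \<and> (\<forall>B'. spanning_cycles G B' \<longrightarrow> card B \<le> card B')"

definition minimum_cycle_basis ::
  "'a ugraph \<Rightarrow> ('a set \<Rightarrow> nat) \<Rightarrow> 'a ugraph set \<Rightarrow> bool" where
  "minimum_cycle_basis G w B \<longleftrightarrow>
     cycle_basis G B \<and>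
     (\<forall>B'. cycle_basis G B' \<longrightarrow> (\<Sum>C\<in>B. weight w C) \<le> (\<Sum>C\<in>B'. weight w C))"

end

theory Submission
  imports Defs
begin

text \<open>
  Cycles are treated as minimal nonempty edge sets without odd-degree vertices, and an edge set whose
  odd-degree vertices are exactly \<open>x\<close> and \<open>y\<close> plays the role of an \<open>x\<close>-\<open>y\<close> path. A positive edge
  weight \<open>W\<close> that encodes weight, number of edges and vertex order lexicographically makes \<open>lsp\<close> the
  unique lightest such set.

  Spanning: if \<open>C\<close> is not lex short, some \<open>P = lsp x y\<close> with \<open>x\<close>, \<open>y\<close> on \<open>C\<close> is not contained in \<open>C\<close>; if
  \<open>Q\<close>, \<open>R\<close> are the arcs of \<open>C\<close> between \<open>x\<close> and \<open>y\<close>, then \<open>C\<close> is the sum of \<open>Q + P\<close> and \<open>R + P\<close>, both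
  lighter than \<open>C\<close>. By induction every cycle is a sum of lex short cycles that are not heavier.

  Independence: induction on the 2-tree \<open>H\<close> containing the graph, for all edge sets \<open>E\<close> and all weights.
  Let \<open>v\<close> be the last vertex of \<open>H\<close>, attached to the edge \<open>xy\<close>. If \<open>xy\<close> is not in \<open>E\<close>, replace the path
  \<open>xvy\<close> by the edge \<open>xy\<close> of the same weight. If \<open>xy\<close> is in \<open>E\<close> and \<open>xvy\<close> is the strictly lightest
  \<open>x\<close>-\<open>y\<close> path, then the triangle is the only short cycle using \<open>xy\<close>, and \<open>xy\<close> can be deleted first.
  Otherwise at most one short cycle passes through \<open>v\<close>.

  Minimality: a basis \<open>B\<close> has at most as many members of weight at most \<open>t\<close> as there are lex short cycles
  of weight at most \<open>t\<close>, because the former are independent and lie in the span of the latter.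
\<close>

subsection \<open>Edge sets by their odd-degree vertices\<close>

text \<open>The boundary of a finite edge set over the two-element field: symmetric difference is
  addition, and the sets with empty boundary form the cycle space.\<close>

definition odd_verts :: "'a set set \<Rightarrow> 'a set" where
  "odd_verts Z = {v. odd (card {e\<in>Z. v \<in> e})}"

definition min_even :: "'a set set \<Rightarrow> bool" where
  "min_even C \<longleftrightarrow> C \<noteq> {} \<and> odd_verts C = {} \<and>
     (\<forall>D\<subseteq>C. D \<noteq> {} \<longrightarrow> odd_verts D = {} \<longrightarrow> D = C)"

text \<open>
  Neither positive weights nor unique lightest paths are assumed here: the strict inequality for sets
  that leave \<open>C\<close> is what remains of lex shortness, and it survives the contraction below.
\<close>

definition short_in :: "'a set set \<Rightarrow> ('a set \<Rightarrow> nat) \<Rightarrow> 'a set set \<Rightarrow> bool" where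
  "short_in E W C \<longleftrightarrow> C \<subseteq> E \<and> min_even C \<and>
     (\<forall>x\<in>\<Union>C. \<forall>y\<in>\<Union>C. \<forall>Z\<subseteq>E. x \<noteq> y \<longrightarrow> odd_verts Z = {x, y} \<longrightarrow>
        Z \<subseteq> C \<or> (\<exists>Z'\<subseteq>C. odd_verts Z' = {x, y} \<and> sum W Z' < sum W Z))"

text \<open>A linear combination over the two-element field is a finite subfamily \<open>F\<close>,
  and its coordinate at \<open>e\<close> is the parity of the number of members through
  \<open>e\<close>.\<close>

definition F2_indep :: "'b set set \<Rightarrow> bool" where
  "F2_indep S \<longleftrightarrow> (\<forall>F\<subseteq>S. finite F \<longrightarrow> (\<forall>e. even (card {C\<in>F. e \<in> C})) \<longrightarrow> F = {})"

lemma even_card_sym_diff: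
  assumes "finite A" "finite B"
  shows "even (card (sym_diff A B)) \<longleftrightarrow> (even (card A) \<longleftrightarrow> even (card B))"
proof -
  have "card A = card (A - B) + card (A \<inter> B)"
    by (metis assms(1) card_Diff_subset_Int card_mono finite_Int inf_le1 le_add_diff_inverse2)
  moreover have "card B = card (B - A) + card (A \<inter> B)"
    by (metis assms(2) card_Diff_subset_Int card_mono finite_Int inf_commute inf_le1 le_add_diff_inverse2)
  moreover have "card (sym_diff A B) = card (A - B) + card (B - A)"
    using assms by (intro card_Un_disjoint) auto
  ultimately show ?thesis by (simp only: even_add) blast
qed

lemma odd_verts_sym_diff:
  assumes "finite A" "finite B"
  shows "odd_verts (sym_diff A B) = sym_diff (odd_verts A) (odd_verts B)"
proof -
  have "{e \<in> sym_diff A B. v \<in> e} = sym_diff {e\<in>A. v \<in> e} {e\<in>B. v \<in> e}" for v by auto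
  then have "even (card {e \<in> sym_diff A B. v \<in> e}) \<longleftrightarrow>
      (even (card {e\<in>A. v \<in> e}) \<longleftrightarrow> even (card {e\<in>B. v \<in> e}))" for v
    using even_card_sym_diff[of "{e\<in>A. v \<in> e}" "{e\<in>B. v \<in> e}"] assms by auto
  then show ?thesis unfolding odd_verts_def by blast
qed

lemma odd_verts_empty [simp]: "odd_verts {} = {}"
  by (simp add: odd_verts_def)

lemma odd_verts_singleton [simp]: "odd_verts {e} = e"
proof -
  have "{f. f = e \<and> v \<in> f} = (if v \<in> e then {e} else {})" for v by auto
  then show ?thesis by (auto simp: odd_verts_def)
qed

lemma odd_verts_insert:
  assumes "finite A" "e \<notin> A"
  shows "odd_verts (insert e A) = sym_diff (odd_verts A) e"
  using odd_verts_sym_diff[of A "{e}"] assms by (simp add: insert_Diff_if Un_commute)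

lemma odd_verts_Diff:
  assumes "finite A" "B \<subseteq> A"
  shows "odd_verts (A - B) = sym_diff (odd_verts A) (odd_verts B)"
proof -
  have "sym_diff A B = A - B" using assms by auto
  then show ?thesis using odd_verts_sym_diff[of A B] assms finite_subset by metis
qed

lemma odd_verts_subset_Union: "odd_verts Z \<subseteq> \<Union>Z"
proof
  fix v assume "v \<in> odd_verts Z"
  then have "{e\<in>Z. v \<in> e} \<noteq> {}" unfolding odd_verts_def by (metis (mono_tags) card.empty even_zero mem_Collect_eq)
  then show "v \<in> \<Union>Z" by auto
qed

text \<open>Shrinking the host set removes competitors \<open>Z\<close> and leaves the replacements
  inside \<open>C\<close> untouched.\<close>

lemma short_in_subset:
  assumes "short_in E W C" "C \<subseteq> E'" "E' \<subseteq> E"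
  shows "short_in E' W C"
  using assms unfolding short_in_def by simp

lemma min_evenD:
  assumes "min_even C" "D \<subseteq> C" "D \<noteq> {}" "odd_verts D = {}"
  shows "D = C"
  using assms unfolding min_even_def by simp

lemma short_inD:
  assumes "short_in E W C"
  shows "C \<subseteq> E" "min_even C" "odd_verts C = {}"
  using assms unfolding short_in_def min_even_def by simp_all

lemma short_in_cases [consumes 6]:
  assumes "short_in E W C" "Z \<subseteq> E" "odd_verts Z = {x, y}" "x \<in> \<Union>C" "y \<in> \<Union>C" "x \<noteq> y"
  obtains "Z \<subseteq> C" | Z' where "Z' \<subseteq> C" "odd_verts Z' = {x, y}" "sum W Z' < sum W Z"
proof -
  have "\<forall>Z\<subseteq>E. x \<noteq> y \<longrightarrow> odd_verts Z = {x, y} \<longrightarrow>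
      Z \<subseteq> C \<or> (\<exists>Z'\<subseteq>C. odd_verts Z' = {x, y} \<and> sum W Z' < sum W Z)"
    using assms(1,4,5) unfolding short_in_def by blast
  then show ?thesis using assms that by metis
qed

lemma F2_indepD:
  assumes "F2_indep S" "F \<subseteq> S" "finite F" "\<And>e. even (card {C\<in>F. e \<in> C})"
  shows "F = {}"
  using assms unfolding F2_indep_def by blast

text \<open>For pruning a vanishing combination: an edge that at most one member can use is used by
  none.\<close>

lemma even_card_le_one:
  assumes "even (card {C\<in>F. P C})" "\<And>C C'. C \<in> F \<Longrightarrow> C' \<in> F \<Longrightarrow> P C \<Longrightarrow> P C' \<Longrightarrow> C = C'" "C \<in> F"
  shows "\<not> P C"
proof
  assume "P C"
  then have "{C\<in>F. P C} = {C}" using assms by auto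
  then show False using assms(1) by simp
qed

subsection \<open>Independence of the short cycles in subgraphs of 2-trees\<close>

locale ear =
  fixes v x y :: 'a and E1 :: "'a set set"
  assumes vx: "v \<noteq> x" and vy: "v \<noteq> y" and xy: "x \<noteq> y"
    and fin: "finite E1" and v: "v \<notin> \<Union>E1"
begin

abbreviation "D \<equiv> {{v, x}, {v, y}}"

lemma edges_distinct [simp]:
  "{v, x} \<noteq> {v, y}" "{v, x} \<noteq> {x, y}" "{v, y} \<noteq> {x, y}" "{x, y} \<noteq> {v, x}" "{x, y} \<noteq> {v, y}"
  using vx vy xy by (auto simp: doubleton_eq_iff)

lemma D_notin [simp]: "{v, x} \<notin> E1" "{v, y} \<notin> E1"
  using v by auto

lemma odd_D: "odd_verts D = {x, y}"
  using vx vy xy by (subst odd_verts_insert) auto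

lemma odd_T: "odd_verts (insert {x, y} D) = {}"
  by (subst odd_verts_insert) (simp_all add: odd_D)

text \<open>The only edges at \<open>v\<close> are the two ear edges, so even degree at
  \<open>v\<close> allows both or neither.\<close>

lemma ear_iff:
  assumes "Z \<subseteq> E1 \<union> D" "v \<notin> odd_verts Z"
  shows "{v, x} \<in> Z \<longleftrightarrow> {v, y} \<in> Z"
proof -
  have "{e\<in>Z. v \<in> e} = Z \<inter> D" using assms(1) v by auto
  then have "even (card (Z \<inter> D))" using assms(2) by (simp add: odd_verts_def)
  then show ?thesis by (cases "{v, x} \<in> Z"; cases "{v, y} \<in> Z") auto
qed

lemma ear_cases:
  assumes "C \<subseteq> E1 \<union> D" "v \<notin> odd_verts C"
  shows "C \<subseteq> E1 \<or> D \<subseteq> C \<and> C - D \<subseteq> E1"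
  using ear_iff[OF assms] assms(1) by auto

lemma fin_sub: "Z \<subseteq> E1 \<union> D \<Longrightarrow> finite Z"
  using fin finite_subset by auto

text \<open>If \<open>Z\<close> avoids \<open>v\<close>, then \<open>Z\<close> together with
  \<open>D\<close> is even and fills the minimal \<open>C\<close>. Otherwise \<open>Z - D\<close> is
  an even proper subset of \<open>C\<close>, hence empty.\<close>

lemma arcs:
  assumes C: "C \<subseteq> E1 \<union> D" "min_even C" "D \<subseteq> C"
    and Z: "Z \<subseteq> C" "odd_verts Z = {x, y}"
  shows "Z = D \<or> Z = C - D"
proof -
  have fZ: "finite Z" using fin_sub C Z by auto
  have Zc: "v \<notin> odd_verts Z" using Z vx vy by auto
  have "Z \<subseteq> E1 \<or> D \<subseteq> Z" using ear_cases[of Z] Zc Z C by auto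
  then show ?thesis
  proof
    assume *: "Z \<subseteq> E1"
    have d: "Z \<inter> D = {}" using * by auto
    have "sym_diff Z D = Z \<union> D" using d by auto
    then have "odd_verts (Z \<union> D) = {}"
      using odd_verts_sym_diff[OF fZ, of D] odd_D Z by simp
    then have "Z \<union> D = C" using min_evenD[OF C(2), of "Z \<union> D"] C(3) Z(1) by simp
    then show ?thesis using d by auto
  next
    assume *: "D \<subseteq> Z"
    then have odd: "odd_verts (Z - D) = {}" using odd_verts_Diff[OF fZ *] odd_D Z by simp
    show ?thesis
    proof (cases "Z - D = {}")
      case True
      then have "Z = D" using * by (simp only: Diff_eq_empty_iff subset_antisym)
      then show ?thesis ..
    next
      case False
      have "Z - D \<subseteq> C" using Z(1) by (rule subset_trans[OF Diff_subset])
      then have "Z - D = C" using min_evenD[OF C(2)] False odd by simp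
      then have "{v, x} \<notin> C" by blast
      then show ?thesis using C(3) by simp
    qed
  qed
qed

lemma rest_odd:
  assumes C: "C \<subseteq> E1 \<union> D" "min_even C" "D \<subseteq> C"
  shows "odd_verts (C - D) = {x, y}"
  using odd_verts_Diff[OF fin_sub[OF C(1)] C(3)] odd_D C(2) unfolding min_even_def by simp

text \<open>Shortness of \<open>C\<close> at \<open>x\<close> and \<open>y\<close> puts into
  \<open>C\<close> either \<open>Z\<close> itself or a strictly lighter set with the same odd
  vertices. By \<open>arcs\<close> that set is \<open>D\<close> or \<open>C - D\<close>; it is not
  \<open>D\<close>, since \<open>Z\<close> differs from \<open>D\<close> and is no heavier.\<close>

lemma short_arc_le:
  assumes C: "short_in E W C" "E \<subseteq> E1 \<union> D" "D \<subseteq> C"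
    and Z: "Z \<subseteq> E" "odd_verts Z = {x, y}" "sum W Z \<le> sum W D" "Z \<noteq> D"
  shows "C - D = Z \<or> sum W (C - D) < sum W Z"
proof -
  have CE: "C \<subseteq> E1 \<union> D" "min_even C" using short_inD[OF C(1)] C(2) by auto
  have xyC: "x \<in> \<Union>C" "y \<in> \<Union>C" using C(3) by auto
  from C(1) Z(1,2) xyC xy show ?thesis
  proof (cases rule: short_in_cases)
    case 1
    have "Z = C - D" using arcs[OF CE C(3) 1 Z(2)] Z(4) by (metis (full_types))
    then show ?thesis by simp
  next
    case (2 Z')
    have "Z' \<noteq> D" using 2(3) Z(3) by auto
    then have "Z' = C - D" using arcs[OF CE C(3) 2(1,2)] by (metis (full_types))
    then show ?thesis using 2(3) by simp
  qed
qed

text \<open>\<open>Z\<close> forces each arc \<open>C - D\<close> to weigh at most as much as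
  \<open>D\<close>, which makes it an admissible competitor against the other cycle. Two distinct
  arcs would each be strictly lighter than the other.\<close>

lemma short_through_unique:
  assumes E: "E \<subseteq> E1 \<union> D"
    and Z: "Z \<subseteq> E \<inter> E1" "odd_verts Z = {x, y}" "sum W Z \<le> sum W D"
    and C1: "short_in E W C1" "D \<subseteq> C1"
    and C2: "short_in E W C2" "D \<subseteq> C2"
  shows "C1 = C2"
proof -
  have nD: "Z \<noteq> D" using Z by auto
  have le: "sum W (C - D) \<le> sum W D" if "short_in E W C" "D \<subseteq> C" for C
    using short_arc_le[OF that(1) E that(2) _ Z(2,3) nD] Z by fastforce
  have cmp: "C - D = C' - D \<or> sum W (C - D) < sum W (C' - D)"
    if "short_in E W C" "D \<subseteq> C" "short_in E W C'" "D \<subseteq> C'" for C C'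
  proof (rule short_arc_le[OF that(1) E that(2)])
    show "C' - D \<subseteq> E" using short_inD[OF that(3)] by auto
    show "odd_verts (C' - D) = {x, y}"
      using short_inD[OF that(3)] that E by (intro rest_odd) auto
    show "sum W (C' - D) \<le> sum W D" using le that by auto
  qed auto
  have "C1 - D = C2 - D" using cmp[OF C1 C2] cmp[OF C2 C1] less_asym by blast
  then show ?thesis using C1(2) C2(2) by (metis Diff_partition)
qed

text \<open>\<open>contract\<close> and \<open>expand\<close> trade the ear for the edge
  \<open>{x, y}\<close> and back. Testing \<open>{v, x}\<close> alone suffices because the sets to
  be contracted have even degree at \<open>v\<close>.\<close>

definition contract :: "'a set set \<Rightarrow> 'a set set" where
  "contract Z = (if {v, x} \<in> Z then insert {x, y} (Z - D) else Z)"

definition expand :: "'a set set \<Rightarrow> 'a set set" where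
  "expand Z = (if {x, y} \<in> Z then (Z - {{x, y}}) \<union> D else Z)"

section \<open>Contraction of the ear when \<open>{x, y}\<close> is not already present\<close>

context
  assumes xyE: "{x, y} \<notin> E1"
begin

lemma contract_subset: "Z \<subseteq> E1 \<union> D \<Longrightarrow> v \<notin> odd_verts Z \<Longrightarrow> contract Z \<subseteq> insert {x, y} E1"
  using ear_iff[of Z] by (auto simp: contract_def)

lemma expand_subset: "Z \<subseteq> insert {x, y} E1 \<Longrightarrow> expand Z \<subseteq> E1 \<union> D"
  by (auto simp: expand_def)

lemma expand_contract: "Z \<subseteq> E1 \<union> D \<Longrightarrow> v \<notin> odd_verts Z \<Longrightarrow> expand (contract Z) = Z"
  using ear_iff[of Z] xyE by (auto simp: contract_def expand_def)

lemma contract_expand: "Z \<subseteq> insert {x, y} E1 \<Longrightarrow> contract (expand Z) = Z"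
  using xyE v vx vy by (auto simp: contract_def expand_def)

text \<open>Contracting a set through \<open>v\<close> adds the triangle
  \<open>insert {x, y} D\<close>, which has no odd vertices.\<close>

lemma odd_verts_contract:
  assumes "Z \<subseteq> E1 \<union> D" "v \<notin> odd_verts Z"
  shows "odd_verts (contract Z) = odd_verts Z"
proof (cases "{v, x} \<in> Z")
  case True
  then have "contract Z = sym_diff Z (insert {x, y} D)"
    using ear_iff[OF assms] assms(1) xyE by (auto simp: contract_def)
  then show ?thesis
    using odd_verts_sym_diff[OF fin_sub[OF assms(1)], of "insert {x, y} D"] odd_T by auto
qed (simp add: contract_def)

lemma odd_verts_expand:
  assumes "Z \<subseteq> insert {x, y} E1"
  shows "odd_verts (expand Z) = odd_verts Z"
proof (cases "{x, y} \<in> Z")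
  case True
  have fZ: "finite Z" using assms fin finite_subset by auto
  have "expand Z = sym_diff Z (insert {x, y} D)"
    using True assms xyE by (auto simp: expand_def)
  then show ?thesis
    using odd_verts_sym_diff[OF fZ, of "insert {x, y} D"] odd_T by auto
qed (simp add: expand_def)

lemma contract_mono:
  assumes "Z \<subseteq> Z'" "Z' \<subseteq> E1 \<union> D" "v \<notin> odd_verts Z" "v \<notin> odd_verts Z'"
  shows "contract Z \<subseteq> contract Z'"
  using assms ear_iff[of Z] ear_iff[of Z'] by (auto simp: contract_def)

lemma expand_mono: "Z \<subseteq> Z' \<Longrightarrow> expand Z \<subseteq> expand Z'"
  by (auto simp: expand_def)

lemma sum_contract:
  assumes "Z \<subseteq> E1 \<union> D" "v \<notin> odd_verts Z"
  shows "sum (W({x, y} := sum W D)) (contract Z) = sum W Z"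
proof (cases "{v, x} \<in> Z")
  case True
  then have D: "D \<subseteq> Z" using ear_iff[OF assms] by auto
  have n: "{x, y} \<notin> Z" using assms(1) xyE edges_distinct by auto
  have f: "finite Z" by (rule fin_sub[OF assms(1)])
  have "sum (W({x, y} := sum W D)) (contract Z) = sum W D + sum (W({x, y} := sum W D)) (Z - D)"
    using True n f unfolding contract_def by (simp add: sum.insert)
  also have "sum (W({x, y} := sum W D)) (Z - D) = sum W (Z - D)"
    using n by (intro sum.cong) auto
  also have "sum W D + sum W (Z - D) = sum W Z"
    using sum.subset_diff[OF D f, of W] by (simp only: add.commute)
  finally show ?thesis .
next
  case False
  have n: "{x, y} \<notin> Z" using assms(1) xyE edges_distinct by auto
  show ?thesis using False n by (auto simp: contract_def intro!: sum.cong)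
qed

text \<open>\<open>contract\<close> and \<open>expand\<close> are inverse, monotone, and preserve
  odd vertices and weight, so minimality and shortness carry over: a competitor \<open>Z\<close> is
  expanded, and the lighter set found in \<open>C\<close> is contracted.\<close>

lemma short_contract:
  assumes "short_in (E1 \<union> D) W C"
  shows "short_in (insert {x, y} E1) (W({x, y} := sum W D)) (contract C)"
proof -
  have C: "C \<subseteq> E1 \<union> D" "min_even C" "odd_verts C = {}"
    using short_inD[OF assms] by simp_all
  have vC: "v \<notin> odd_verts C" using C by simp
  have sub: "contract C \<subseteq> insert {x, y} E1" using contract_subset C vC by auto
  have "min_even (contract C)"
    unfolding min_even_def
  proof (intro conjI allI impI)
    show "contract C \<noteq> {}" using C(2) unfolding min_even_def contract_def by auto
    show "odd_verts (contract C) = {}" using odd_verts_contract C vC by auto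
    fix B assume B: "B \<subseteq> contract C" "B \<noteq> {}" "odd_verts B = {}"
    have B': "B \<subseteq> insert {x, y} E1" using B sub by auto
    have "expand B \<subseteq> C" using expand_mono[OF B(1)] expand_contract[OF C(1) vC] by simp
    moreover have "expand B \<noteq> {}" using B(2) unfolding expand_def by auto
    moreover have "odd_verts (expand B) = {}" using odd_verts_expand B' B by simp
    ultimately have "expand B = C" using C(2) unfolding min_even_def by blast
    then show "B = contract C" using contract_expand[OF B'] by simp
  qed
  moreover have "Z \<subseteq> contract C \<or> (\<exists>Z'\<subseteq>contract C. odd_verts Z' = {a, b} \<and>
       sum (W({x, y} := sum W D)) Z' < sum (W({x, y} := sum W D)) Z)"
    if ab: "a \<in> \<Union>(contract C)" "b \<in> \<Union>(contract C)" "a \<noteq> b"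
      and Z: "Z \<subseteq> insert {x, y} E1" "odd_verts Z = {a, b}" for a b Z
  proof -
    have sU: "\<Union>(contract C) \<subseteq> \<Union>C" using ear_iff[OF C(1) vC] by (auto simp: contract_def)
    \<comment> \<open>No edge meets \<open>v\<close> after contraction, so \<open>a\<close> and
      \<open>b\<close> differ from \<open>v\<close> and all sets involved have even degree
      there.\<close>
    have av: "a \<noteq> v" "b \<noteq> v" using ab sub v vx vy by auto
    have odd: "odd_verts (expand Z) = {a, b}" using odd_verts_expand Z by simp
    then have vZ: "v \<notin> odd_verts (expand Z)" using av by auto
    have es: "expand Z \<subseteq> E1 \<union> D" using expand_subset Z by auto
    have abC: "a \<in> \<Union>C" "b \<in> \<Union>C" using ab sU by auto
    from assms es odd abC ab(3) show ?thesis
    proof (cases rule: short_in_cases)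
      case 1
      then have "contract (expand Z) \<subseteq> contract C" using contract_mono C vC vZ by blast
      then show ?thesis using contract_expand Z by simp
    next
      case (2 Z')
      have Z'1: "Z' \<subseteq> E1 \<union> D" "v \<notin> odd_verts Z'" using 2 C av by auto
      have "sum (W({x, y} := sum W D)) (contract Z') < sum (W({x, y} := sum W D)) (contract (expand Z))"
        by (simp only: sum_contract[OF Z'1] sum_contract[OF es vZ] 2)
      then have "sum (W({x, y} := sum W D)) (contract Z') < sum (W({x, y} := sum W D)) Z"
        by (simp only: contract_expand[OF Z(1)])
      moreover have "contract Z' \<subseteq> contract C" "odd_verts (contract Z') = {a, b}"
        using contract_mono[OF 2(1) C(1) Z'1(2) vC] odd_verts_contract[OF Z'1] 2 by auto
      ultimately show ?thesis by blast
    qed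
  qed
  ultimately show ?thesis using sub unfolding short_in_def by simp
qed

lemma indep_contract:
  assumes "F2_indep {C. short_in (insert {x, y} E1) (W({x, y} := sum W D)) C}"
  shows "F2_indep {C. short_in (E1 \<union> D) W C}"
  unfolding F2_indep_def
proof (intro allI impI)
  fix F assume F: "F \<subseteq> {C. short_in (E1 \<union> D) W C}" "finite F" and
    ev: "\<forall>e. even (card {C\<in>F. e \<in> C})"
  have FC: "C \<subseteq> E1 \<union> D" "v \<notin> odd_verts C" if "C \<in> F" for C
    using F that short_inD[of "E1 \<union> D" W C] by auto
  have inj: "inj_on contract F"
    by (rule inj_on_inverseI[where g = expand]) (use expand_contract FC in auto)
  have "contract ` F = {}"
  proof (rule F2_indepD[OF assms])
    show "contract ` F \<subseteq> {C. short_in (insert {x, y} E1) (W({x, y} := sum W D)) C}"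
      using F short_contract by auto
    show "finite (contract ` F)" using F by simp
    fix e
    \<comment> \<open>The coordinate at the new edge \<open>{x, y}\<close> is read off at
      \<open>{v, x}\<close>. Ear edges do not occur after contraction, hence the guard
      \<open>e \<notin> D\<close> below.\<close>
    define f where "f = (if e = {x, y} then {v, x} else e)"
    have "e \<in> contract C \<longleftrightarrow> (e \<notin> D \<and> f \<in> C)" if "C \<in> F" for C
      using FC[OF that] ear_iff[OF FC[OF that]] xyE unfolding f_def contract_def by auto
    then have "{C \<in> contract ` F. e \<in> C} = contract ` {C\<in>F. e \<notin> D \<and> f \<in> C}" by auto
    then have "card {C \<in> contract ` F. e \<in> C} = card {C\<in>F. e \<notin> D \<and> f \<in> C}"
      using inj by (metis (no_types, lifting) card_image inj_on_subset mem_Collect_eq subsetI)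
    also have "even \<dots>" using ev by (cases "e \<in> D") auto
    finally show "even (card {C \<in> contract ` F. e \<in> C})" .
  qed
  then show "F = {}" by simp
qed

end

end

section \<open>Independence by induction over the construction of the 2-tree\<close>

lemma F2_indep_restrict:
  assumes "F2_indep {C. short_in E' W C}" "E' \<subseteq> E"
    and "\<And>C. C \<in> F \<Longrightarrow> short_in E W C" "\<And>C. C \<in> F \<Longrightarrow> C \<subseteq> E'"
    and "finite F" "\<And>e. even (card {C\<in>F. e \<in> C})"
  shows "F = {}"
  by (rule F2_indepD[OF assms(1) _ assms(5,6)])
    (use short_in_subset[OF assms(3) assms(4) assms(2)] in auto)

text \<open>\<open>E0\<close> is the edge set of the smaller 2-tree. The hypothesis ranges over all
  edge sets and weights because contraction changes both.\<close>

lemma indep_add_ear: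
  assumes fin: "finite E0" and v: "v \<notin> \<Union>E0" and xyE: "{x, y} \<in> E0" and xy: "x \<noteq> y"
    and IH: "\<And>E W. E \<subseteq> E0 \<Longrightarrow> F2_indep {C. short_in E W C}"
    and E: "E \<subseteq> E0 \<union> {{v, x}, {v, y}}"
  shows "F2_indep {C. short_in E W C}"
proof -
  define E1 where "E1 = E \<inter> E0"
  define D where "D = {{v, x}, {v, y}}"
  have E1: "E1 \<subseteq> E0" "E1 \<subseteq> E" "E \<subseteq> E1 \<union> D" using E by (auto simp: E1_def D_def)
  interpret ear v x y E1
    using v xyE xy fin E1 finite_subset by unfold_locales auto
  show ?thesis
    unfolding F2_indep_def
  proof (intro allI impI)
    fix F assume F: "F \<subseteq> {C. short_in E W C}" "finite F" and
      ev: "\<forall>e. even (card {C\<in>F. e \<in> C})"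
    have sF: "short_in E W C" if "C \<in> F" for C using F that by auto
    have CE: "C \<subseteq> E1 \<union> D" "C \<subseteq> E" "v \<notin> odd_verts C" "min_even C" if "C \<in> F" for C
      using short_inD[OF sF[OF that]] E1 by auto
    have cs: "C \<subseteq> E1 \<or> D \<subseteq> C \<and> C - D \<subseteq> E1" if "C \<in> F" for C
      using ear_cases[of C] CE[OF that] unfolding D_def by auto
    have avoid: "F = {}" if "\<And>C. C \<in> F \<Longrightarrow> C \<subseteq> E1"
      by (rule F2_indep_restrict[OF IH[OF E1(1)] E1(2) sF that F(2)]) (use ev in auto)
    show "F = {}"
    proof (cases "D \<subseteq> E")
      case False
      \<comment> \<open>With an ear edge missing, no member of \<open>F\<close> passes through
        \<open>v\<close>.\<close>
      then show ?thesis using avoid cs CE by blast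
    next
      case True
      then have Eeq: "E = E1 \<union> D" using E1 by auto
      show ?thesis
      proof (cases "\<exists>Z\<subseteq>E1. odd_verts Z = {x, y} \<and> sum W Z \<le> sum W D")
        case True
        then obtain Z where Z: "Z \<subseteq> E1" "odd_verts Z = {x, y}" "sum W Z \<le> sum W D" by blast
        \<comment> \<open>At most one short cycle contains the ear, so parity at
          \<open>{v, x}\<close> excludes it from \<open>F\<close>.\<close>
        have "C1 = C2" if "C1 \<in> F" "C2 \<in> F" "D \<subseteq> C1" "D \<subseteq> C2" for C1 C2
          using short_through_unique[of E Z W C1 C2] Z E1 sF that unfolding D_def by auto
        moreover have "D \<subseteq> C" if "C \<in> F" "{v, x} \<in> C" for C using cs[OF that(1)] that by auto
        ultimately have "{v, x} \<notin> C" if "C \<in> F" for C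
          using even_card_le_one[of F "\<lambda>C. {v, x} \<in> C" C] ev that by auto
        then show ?thesis using avoid cs unfolding D_def by auto
      next
        case False
        \<comment> \<open>Every \<open>x\<close>-\<open>y\<close> set inside \<open>E1\<close> is
          now heavier than the ear. Removing \<open>{x, y}\<close> lets the ear be contracted to
          that edge without a collision.\<close>
        define E2 where "E2 = E1 - {{x, y}}"
        interpret e2: ear v x y E2
          using vx vy xy fin v by unfold_locales (auto simp: E2_def)
        have "C = insert {x, y} D" if C: "C \<in> F" "{x, y} \<in> C" for C
        proof -
          have "D \<subseteq> C"
          proof (rule ccontr)
            assume n: "\<not> D \<subseteq> C"
            then have "C \<subseteq> E1" using cs C by auto
            \<comment> \<open>The competitor is the ear \<open>D\<close> itself: it is not contained
              in \<open>C\<close>, so shortness yields a strictly lighter set in \<open>C\<close>,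
              contrary to the present case.\<close>
            moreover have "\<exists>Z'\<subseteq>C. odd_verts Z' = {x, y} \<and> sum W Z' < sum W D"
            proof -
              have xyC: "x \<in> \<Union>C" "y \<in> \<Union>C" using C by auto
              from sF[OF C(1)] \<open>D \<subseteq> E\<close> odd_D[folded D_def] xyC xy show ?thesis
                by (cases rule: short_in_cases) (use n in auto)
            qed
            ultimately show False using False by (meson less_imp_le subset_trans)
          qed
          then have "insert {x, y} D \<subseteq> C" using C(2) by simp
          then show ?thesis
            using min_evenD[OF CE(4)[OF C(1)]] odd_T[folded D_def] by blast
        qed
        then have no: "{x, y} \<notin> C" if "C \<in> F" for C
          by (intro even_card_le_one[of F "\<lambda>C. {x, y} \<in> C" C]) (use ev that in auto)
        \<comment> \<open>Since \<open>{x, y}\<close> is an edge of the smaller 2-tree, the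
          contracted edge set falls under the induction hypothesis.\<close>
        have "{x, y} \<notin> E2" "insert {x, y} E2 \<subseteq> E0" using E1 xyE by (auto simp: E2_def)
        then have ind: "F2_indep {C. short_in (E2 \<union> D) W C}"
          using e2.indep_contract[OF _ IH] unfolding D_def by simp
        show ?thesis
          by (rule F2_indep_restrict[OF ind _ sF _ F(2)])
            (use ev no CE E1 Eeq in \<open>auto simp: E2_def\<close>)
      qed
    qed
  qed
qed

lemma two_tree_edges:
  assumes "two_tree H"
  shows "finite (edges H) \<and> (\<forall>e\<in>edges H. e \<subseteq> verts H \<and> card e = 2)"
  using assms
proof induction
  case (K3 V)
  then have "finite V" by (simp add: card_ge_0_finite)
  then have "finite {e. e \<subseteq> V \<and> card e = 2}" by simp
  then show ?case by simp
next
  case (add_vertex G x y v)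
  then have "{x, y} \<subseteq> verts G" by blast
  then have "x \<in> verts G" "y \<in> verts G" by simp_all
  then have "v \<noteq> x" "v \<noteq> y" using add_vertex.hyps by auto
  then show ?case using add_vertex.IH \<open>x \<in> verts G\<close> \<open>y \<in> verts G\<close> by auto
qed

lemma indep_single:
  assumes "\<And>C. C \<in> S \<Longrightarrow> C \<noteq> {}" "\<And>C C'. C \<in> S \<Longrightarrow> C' \<in> S \<Longrightarrow> C = C'"
  shows "F2_indep S"
  unfolding F2_indep_def
proof (intro allI impI)
  fix F assume F: "F \<subseteq> S" "finite F" and ev: "\<forall>e. even (card {C\<in>F. e \<in> C})"
  show "F = {}"
  proof (rule ccontr)
    assume "F \<noteq> {}"
    then obtain C where C: "C \<in> F" by auto
    then obtain e where e: "e \<in> C" using assms(1) F by blast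
    have "C1 = C2" if "C1 \<in> F" "C2 \<in> F" for C1 C2 using assms(2) F that by blast
    then have "e \<notin> C" using even_card_le_one[of F "\<lambda>C. e \<in> C" C] ev C by simp
    then show False using e by simp
  qed
qed

lemma indep_short_two_tree:
  assumes "two_tree H" "E \<subseteq> edges H"
  shows "F2_indep {C. short_in E W C}"
  using assms
proof (induction arbitrary: E W)
  case (K3 V)
  obtain a b c where V: "V = {a, b, c}" "a \<noteq> b" "b \<noteq> c" "a \<noteq> c"
    using K3(1) unfolding card_3_iff by blast
  \<comment> \<open>The triangle is viewed as an ear over the single edge \<open>{a, b}\<close>; its
    only nonempty even subset is the whole triangle.\<close>
  interpret ear c a b "{{a, b}}"
    using V by unfold_locales auto
  have "e \<in> insert {a, b} D" if "e \<subseteq> V" "card e = 2" for e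
  proof -
    obtain p q where e: "e = {p, q}" "p \<noteq> q" using \<open>card e = 2\<close> unfolding card_2_iff by blast
    then have "p \<in> {a, b, c}" "q \<in> {a, b, c}" using that V by auto
    then show ?thesis using e by (auto simp: doubleton_eq_iff)
  qed
  then have sub: "E \<subseteq> {{a, b}} \<union> D" using K3.prems by auto
  have one: "C = insert {a, b} D" if "short_in E W C" for C
  proof -
    have C: "C \<subseteq> {{a, b}} \<union> D" "C \<noteq> {}" "odd_verts C = {}"
      using short_inD[OF that] sub unfolding min_even_def by simp_all
    have "\<not> C \<subseteq> {{a, b}}"
    proof
      assume "C \<subseteq> {{a, b}}"
      then have "C = {{a, b}}" using C(2) by (simp only: subset_singleton_iff) simp
      then show False using C(3) by simp
    qed
    then have DC: "D \<subseteq> C" using ear_cases[of C] C by simp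
    have "{a, b} \<in> C"
    proof (rule ccontr)
      assume "{a, b} \<notin> C"
      then have "C = D" using C(1) DC by blast
      then show False using C(3) odd_D by simp
    qed
    then show ?thesis using C(1) DC by blast
  qed
  show ?case
  proof (rule indep_single)
    show "C \<noteq> {}" if "C \<in> {C. short_in E W C}" for C
      using one[of C] that by simp
    show "C = C'" if "C \<in> {C. short_in E W C}" "C' \<in> {C. short_in E W C}" for C C'
      using one[of C] one[of C'] that by simp
  qed
next
  case (add_vertex H x y v)
  have H: "finite (edges H)" "\<And>e. e \<in> edges H \<Longrightarrow> e \<subseteq> verts H \<and> card e = 2"
    using two_tree_edges[OF add_vertex.hyps(1)] by auto
  have "x \<noteq> y" using H(2)[OF add_vertex.hyps(2)] by auto
  moreover have "v \<notin> \<Union>(edges H)" using H(2) add_vertex.hyps(3) by auto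
  ultimately show ?case
    using indep_add_ear[OF H(1) _ add_vertex.hyps(2) _ add_vertex.IH] add_vertex.prems by simp
qed

subsection \<open>Paths and cycles as edge sets\<close>

abbreviation path_edges :: "'a list \<Rightarrow> 'a set set" where
  "path_edges p \<equiv> edges (walk_graph p)"

lemma path_edges_Nil [simp]: "path_edges [] = {}"
  and path_edges_single [simp]: "path_edges [x] = {}"
  by (simp_all add: walk_graph_def)

lemma path_edges_Cons [simp]: "path_edges (x # y # p) = insert {x, y} (path_edges (y # p))"
proof -
  have "{{(x # y # p) ! i, (x # y # p) ! Suc i} | i. Suc i < length (x # y # p)}
      = (\<lambda>i. {(x # y # p) ! i, (x # y # p) ! Suc i}) ` {..<Suc (length p)}" by auto
  also have "\<dots> = insert {x, y} ((\<lambda>i. {(y # p) ! i, (y # p) ! Suc i}) ` {..<length p})"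
    by (simp add: lessThan_Suc_eq_insert_0 image_image)
  finally show ?thesis by (auto simp: walk_graph_def)
qed

lemma verts_walk_graph [simp]: "verts (walk_graph p) = set p"
  by (simp add: walk_graph_def)

lemma finite_path_edges [simp]: "finite (path_edges p)"
  by (induction p rule: induct_list012) auto

lemma path_edges_subset_set: "e \<in> path_edges p \<Longrightarrow> e \<subseteq> set p"
  by (induction p rule: induct_list012) auto

lemma set_subset_path_edges: "length p \<ge> 2 \<Longrightarrow> set p \<subseteq> \<Union>(path_edges p)"
proof (induction p rule: induct_list012)
  case (3 x y zs)
  then show ?case by (cases zs) auto
qed auto

lemma path_edges_append: "path_edges (as @ z # bs) = path_edges (as @ [z]) \<union> path_edges (z # bs)"
  by (induction as rule: induct_list012) auto

lemma path_edges_snoc: "p \<noteq> [] \<Longrightarrow> path_edges (p @ [z]) = insert {last p, z} (path_edges p)"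
  by (induction p rule: induct_list012) auto

lemma Cons_notin_path_edges: "x \<notin> set p \<Longrightarrow> x \<in> e \<Longrightarrow> e \<notin> path_edges p"
  using path_edges_subset_set[of e p] by blast

text \<open>The symmetric difference lets a one-vertex path come out with no odd vertex.\<close>

lemma odd_verts_path:
  "distinct p \<Longrightarrow> p \<noteq> [] \<Longrightarrow> odd_verts (path_edges p) = sym_diff {hd p} {last p}"
proof (induction p rule: induct_list012)
  case (3 x y zs)
  have "odd_verts (path_edges (x # y # zs)) = sym_diff (sym_diff {y} {last (y # zs)}) {x, y}"
    using 3 Cons_notin_path_edges[of x "y # zs" "{x, y}"] by (simp add: odd_verts_insert)
  moreover have "last (y # zs) \<in> set (y # zs)" by (rule last_in_set) simp
  ultimately show ?case using 3(3) by auto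
qed auto

text \<open>After removing an edge \<open>{x, a}\<close> the odd vertices are \<open>a\<close> and
  \<open>y\<close>, so the rest contains a path from \<open>a\<close> to \<open>y\<close>. Either
  \<open>x\<close> is put in front of it or, if the path already visits \<open>x\<close>, its part
  from \<open>x\<close> on is kept.\<close>

lemma odd_verts_contains_path:
  assumes "finite Z" "\<And>e. e \<in> Z \<Longrightarrow> card e = 2" "odd_verts Z = {x, y}" "x \<noteq> y"
  shows "\<exists>p. p \<noteq> [] \<and> hd p = x \<and> last p = y \<and> distinct p \<and> path_edges p \<subseteq> Z"
  using assms
proof (induction Z arbitrary: x rule: finite_psubset_induct)
  case (psubset Z)
  have "x \<in> \<Union>Z" using psubset.prems odd_verts_subset_Union[of Z] by auto
  then obtain e where e: "e \<in> Z" "x \<in> e" by auto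
  then obtain a where a: "e = {x, a}" "a \<noteq> x"
    using psubset.prems(1)[OF e(1)] by (metis card_2_iff doubleton_eq_iff insertE singletonD)
  show ?case
  proof (cases "a = y")
    case True
    then show ?thesis using e a psubset.prems by (intro exI[of _ "[x, y]"]) auto
  next
    case False
    have "odd_verts (Z - {e}) = sym_diff {x, y} {x, a}"
      using odd_verts_Diff[OF psubset.hyps, of "{e}"] e a psubset.prems by simp
    then have odd: "odd_verts (Z - {e}) = {a, y}" using a False psubset.prems by auto
    have "\<exists>p. p \<noteq> [] \<and> hd p = a \<and> last p = y \<and> distinct p \<and> path_edges p \<subseteq> Z - {e}"
      by (rule psubset.IH) (use e psubset.prems odd False in auto)
    then obtain p where p: "p \<noteq> []" "hd p = a" "last p = y" "distinct p" "path_edges p \<subseteq> Z - {e}"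
      by blast
    show ?thesis
    proof (cases "x \<in> set p")
      case True
      then obtain as bs where s: "p = as @ x # bs" by (meson split_list)
      have "path_edges (x # bs) \<subseteq> Z" using path_edges_append[of as x bs] p(5) s by blast
      then show ?thesis using p s by (intro exI[of _ "x # bs"]) auto
    next
      case False
      obtain q where "p = a # q" using p by (cases p) auto
      then show ?thesis using p e a False by (intro exI[of _ "x # p"]) auto
    qed
  qed
qed

text \<open>The first vertex of a path meets one edge only, so an even set avoids that edge; the
  path is peeled from the front.\<close>

lemma path_edges_acyclic:
  "distinct p \<Longrightarrow> Z \<subseteq> path_edges p \<Longrightarrow> odd_verts Z = {} \<Longrightarrow> Z = {}"
proof (induction p arbitrary: Z rule: induct_list012)
  case (3 x y zs)
  have "{x, y} \<notin> Z"
  proof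
    assume xy: "{x, y} \<in> Z"
    have "e = {x, y}" if "e \<in> Z" "x \<in> e" for e
    proof (rule ccontr)
      assume "e \<noteq> {x, y}"
      then have "e \<in> path_edges (y # zs)" using that 3(4) by auto
      then show False using Cons_notin_path_edges[of x "y # zs" e] that 3(3) by simp
    qed
    then have "{e\<in>Z. x \<in> e} = {{x, y}}" using xy by blast
    then have "x \<in> odd_verts Z" by (simp add: odd_verts_def)
    then show False using 3(5) by simp
  qed
  then have "Z \<subseteq> path_edges (y # zs)" using 3(4) by auto
  then show ?case using 3 by simp
qed auto

lemma cycle_edges:
  assumes "length p \<ge> 3" "distinct p"
  shows "path_edges (p @ [hd p]) = insert {last p, hd p} (path_edges p)"
    and "{last p, hd p} \<notin> path_edges p" and "last p \<noteq> hd p"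
proof -
  obtain a b c q where p: "p = a # b # c # q"
    using assms(1) by (auto simp: numeral_3_eq_3 Suc_le_length_iff)
  have l: "last p \<in> set (c # q)" using p by auto
  show "path_edges (p @ [hd p]) = insert {last p, hd p} (path_edges p)"
    using path_edges_snoc[of p "hd p"] p by simp
  show "last p \<noteq> hd p" using l assms p by auto
  have "{last p, a} \<noteq> {a, b}" using l assms p by (auto simp: doubleton_eq_iff)
  moreover have "{last p, a} \<notin> path_edges (b # c # q)"
    by (rule Cons_notin_path_edges[of a]) (use assms p in auto)
  ultimately show "{last p, hd p} \<notin> path_edges p" using p by simp
qed

text \<open>Removing the closing edge leaves a path, which has no nonempty even subset. A nonempty
  even \<open>D\<close> therefore contains the closing edge, and its complement in the cycle is an
  even subset of the path.\<close>

lemma min_even_cycle: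
  assumes "length p \<ge> 3" "distinct p"
  shows "min_even (path_edges (p @ [hd p]))"
proof -
  let ?f = "{last p, hd p}" and ?C = "path_edges (p @ [hd p])"
  note c = cycle_edges[OF assms]
  have p: "p \<noteq> []" using assms by auto
  have "odd_verts ?C = sym_diff (sym_diff {hd p} {last p}) ?f"
    unfolding c(1) using odd_verts_insert[OF finite_path_edges c(2)] odd_verts_path[OF assms(2) p]
    by simp
  then have odd: "odd_verts ?C = {}" using c(3) by auto
  have "D = ?C" if D: "D \<subseteq> ?C" "D \<noteq> {}" "odd_verts D = {}" for D
  proof -
    have "?f \<in> D"
    proof (rule ccontr)
      assume "?f \<notin> D"
      then have "D \<subseteq> path_edges p" using D c(1) by auto
      then show False using path_edges_acyclic assms(2) D by blast
    qed
    then have "?C - D \<subseteq> path_edges p" using c(1) by auto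
    moreover have "odd_verts (?C - D) = {}"
      using odd_verts_Diff[OF finite_path_edges D(1)] odd D by simp
    ultimately have "?C - D = {}" using path_edges_acyclic assms(2) by blast
    then show ?thesis using D by blast
  qed
  then show ?thesis using odd c(1) unfolding min_even_def by blast
qed

lemma even_contains_cycle:
  assumes "finite Z" "\<And>e. e \<in> Z \<Longrightarrow> card e = 2" "odd_verts Z = {}" "Z \<noteq> {}"
  shows "\<exists>p. length p \<ge> 3 \<and> distinct p \<and> path_edges (p @ [hd p]) \<subseteq> Z"
proof -
  obtain e where e: "e \<in> Z" using assms by auto
  then obtain a b where ab: "e = {a, b}" "a \<noteq> b" using assms(2) by (metis card_2_iff)
  have "odd_verts (Z - {e}) = {a, b}"
    using odd_verts_Diff[OF assms(1), of "{e}"] e ab assms by simp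
  then obtain p where p: "p \<noteq> []" "hd p = a" "last p = b" "distinct p" "path_edges p \<subseteq> Z - {e}"
    using odd_verts_contains_path[of "Z - {e}" a b] assms ab by auto
  obtain q where q: "p = a # q" using p by (cases p) auto
  then obtain c r where r: "p = a # c # r" using p ab by (cases q) auto
  \<comment> \<open>A path with just the vertices \<open>a\<close> and \<open>b\<close> would use
    the deleted edge \<open>e\<close>.\<close>
  then have "r \<noteq> []" using p ab by auto
  then have "length p \<ge> 3" using r by (cases r) auto
  moreover have "path_edges (p @ [hd p]) \<subseteq> Z"
    using path_edges_snoc[OF p(1), of "hd p"] p e ab by (auto simp: insert_commute)
  ultimately show ?thesis using p by blast
qed

lemma path_prefix:
  assumes "distinct p" "x \<in> set p"
  shows "\<exists>Q\<subseteq>path_edges p. odd_verts Q = sym_diff {hd p} {x}"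
proof -
  obtain as bs where s: "p = as @ x # bs" using assms by (meson split_list)
  have "path_edges (as @ [x]) \<subseteq> path_edges p" using path_edges_append[of as x bs] s by blast
  moreover have "odd_verts (path_edges (as @ [x])) = sym_diff {hd p} {x}"
    using odd_verts_path[of "as @ [x]"] assms s by (simp add: hd_append)
  ultimately show ?thesis by blast
qed

text \<open>The initial segments ending at \<open>x\<close> and at \<open>y\<close> are added; the
  contribution of \<open>hd p\<close> cancels.\<close>

lemma path_arc:
  assumes "distinct p" "x \<in> set p" "y \<in> set p"
  shows "\<exists>Q\<subseteq>path_edges p. odd_verts Q = sym_diff {x} {y}"
proof -
  obtain Qx Qy where Q: "Qx \<subseteq> path_edges p" "odd_verts Qx = sym_diff {hd p} {x}"
    "Qy \<subseteq> path_edges p" "odd_verts Qy = sym_diff {hd p} {y}"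
    using path_prefix assms by metis
  have f: "finite Qx" "finite Qy"
    by (rule finite_subset[OF _ finite_path_edges], rule Q)+
  have "odd_verts (sym_diff Qx Qy) = sym_diff (sym_diff {hd p} {x}) (sym_diff {hd p} {y})"
    by (simp only: odd_verts_sym_diff[OF f] Q)
  also have "\<dots> = sym_diff {x} {y}" by auto
  finally have "odd_verts (sym_diff Qx Qy) = sym_diff {x} {y}" .
  moreover have "sym_diff Qx Qy \<subseteq> path_edges p" using Q by blast
  ultimately show ?thesis by blast
qed

lemma sum_sym_diff_le:
  fixes W :: "'b \<Rightarrow> nat"
  assumes "finite A" "finite B"
  shows "sum W (sym_diff A B) \<le> sum W A + sum W B"
proof -
  have "sum W (sym_diff A B) = sum W (A - B) + sum W (B - A)"
    using assms by (intro sum.union_disjoint) auto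
  also have "\<dots> \<le> sum W A + sum W B"
    using assms by (intro add_mono sum_mono2) auto
  finally show ?thesis .
qed

text \<open>In a minimum-weight path every initial segment is of minimum weight, so the vertices occur in
  the order of their distance from the first one.\<close>

lemma min_path_sorted:
  fixes W :: "'a set \<Rightarrow> nat"
  defines "d u E z \<equiv> LEAST n. \<exists>Z\<subseteq>E. odd_verts Z = sym_diff {u} {z} \<and> n = sum W Z"
  assumes E: "finite E" "\<And>e. e \<in> E \<Longrightarrow> card e = 2" "\<And>e. e \<in> E \<Longrightarrow> W e > 0"
    and p: "p \<noteq> []" "distinct p" "path_edges p \<subseteq> E" "hd p \<noteq> last p"
    and min: "\<And>Z. Z \<subseteq> E \<Longrightarrow> odd_verts Z = {hd p, last p} \<Longrightarrow> sum W (path_edges p) \<le> sum W Z"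
  shows "sorted_wrt (\<lambda>a b. d (hd p) E a < d (hd p) E b) p"
proof -
  let ?u = "hd p" and ?v = "last p"
  have d: "d ?u E (p ! i) = sum W (path_edges (take (Suc i) p))" if i: "i < length p" for i
  proof -
    define as z bs where s: "as = take i p" "z = p ! i" "bs = drop (Suc i) p"
    have p_eq: "p = as @ z # bs" using id_take_nth_drop[OF i] s by simp
    have tk: "take (Suc i) p = as @ [z]" using take_Suc_conv_app_nth[OF i] s by simp
    have un: "path_edges p = path_edges (as @ [z]) \<union> path_edges (z # bs)"
      using path_edges_append p_eq by metis
    have odd1: "odd_verts (path_edges (as @ [z])) = sym_diff {?u} {z}"
      using odd_verts_path[of "as @ [z]"] p p_eq by (simp add: hd_append)
    have odd2: "odd_verts (path_edges (z # bs)) = sym_diff {z} {?v}"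
      using odd_verts_path[of "z # bs"] p p_eq by simp
    have "path_edges (as @ [z]) \<inter> path_edges (z # bs) = {}"
    proof (rule ccontr)
      assume "\<not> ?thesis"
      then obtain e where e: "e \<in> path_edges (as @ [z])" "e \<in> path_edges (z # bs)" by blast
      then have "e \<subseteq> set (as @ [z]) \<inter> set (z # bs)"
        using path_edges_subset_set by (intro Int_greatest)
      also have "\<dots> \<subseteq> {z}" using p p_eq by auto
      finally have "card e \<le> 1" using card_mono[of "{z}" e] by simp
      then show False using E(2)[of e] e un p(3) by auto
    qed
    then have total: "sum W (path_edges p) = sum W (path_edges (as @ [z])) + sum W (path_edges (z # bs))"
      unfolding un by (intro sum.union_disjoint) auto
    \<comment> \<open>Exchange argument: \<open>Z\<close> added to the final segment still joins the
      two ends, so minimality of the whole path applies and the weight of the final segment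
      cancels.\<close>
    have "sum W (path_edges (as @ [z])) \<le> sum W Z"
      if Z: "Z \<subseteq> E" "odd_verts Z = sym_diff {?u} {z}" for Z
    proof -
      have f: "finite Z" using Z E finite_subset by blast
      have "odd_verts (sym_diff Z (path_edges (z # bs))) = sym_diff (sym_diff {?u} {z}) (sym_diff {z} {?v})"
        by (simp only: odd_verts_sym_diff[OF f finite_path_edges] Z odd2)
      also have "\<dots> = {?u, ?v}" using p(4) by auto
      finally have "odd_verts (sym_diff Z (path_edges (z # bs))) = {?u, ?v}" .
      moreover have "sym_diff Z (path_edges (z # bs)) \<subseteq> E" using Z un p(3) by auto
      ultimately have "sum W (path_edges p) \<le> sum W (sym_diff Z (path_edges (z # bs)))"
        using min by blast
      also have "\<dots> \<le> sum W Z + sum W (path_edges (z # bs))"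
        by (rule sum_sym_diff_le) (use f in auto)
      finally show ?thesis using total by simp
    qed
    moreover have "path_edges (as @ [z]) \<subseteq> E" using un p(3) by blast
    ultimately have "(LEAST n. \<exists>Z\<subseteq>E. odd_verts Z = sym_diff {?u} {z} \<and> n = sum W Z)
        = sum W (path_edges (as @ [z]))"
      using odd1 by (intro Least_equality) blast+
    then show ?thesis using tk s unfolding d_def by simp
  qed
  have "d ?u E (p ! i) < d ?u E (p ! Suc i)" if i: "Suc i < length p" for i
  proof -
    have tk: "take (Suc (Suc i)) p = take (Suc i) p @ [p ! Suc i]"
      by (rule take_Suc_conv_app_nth[OF i])
    have l: "last (take (Suc i) p) = p ! i" using i by (simp add: take_Suc_conv_app_nth)
    have pe: "path_edges (take (Suc (Suc i)) p) = insert {p ! i, p ! Suc i} (path_edges (take (Suc i) p))"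
      unfolding tk using l i by (subst path_edges_snoc) auto
    have "distinct (take (Suc (Suc i)) p)" using p by simp
    then have "p ! Suc i \<notin> set (take (Suc i) p)" unfolding tk by simp
    then have n: "{p ! i, p ! Suc i} \<notin> path_edges (take (Suc i) p)"
      using Cons_notin_path_edges by fastforce
    have "path_edges (take (Suc (Suc i)) p) \<union> path_edges (drop (Suc i) p) = path_edges p"
      using path_edges_append[of "take (Suc i) p" "p ! Suc i" "drop (Suc (Suc i)) p"]
        id_take_nth_drop[OF i] tk Cons_nth_drop_Suc[OF i] by simp
    then have "{p ! i, p ! Suc i} \<in> E" using pe p(3) by blast
    then have "W {p ! i, p ! Suc i} > 0" using E by blast
    then show ?thesis using d[of i] d[of "Suc i"] i pe n by simp
  qed
  then show ?thesis by (subst sorted_wrt_iff_nth_Suc_transp) (auto intro: transpI)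
qed

text \<open>Both lists are strictly sorted by the same distance from \<open>u\<close>, so a common
  vertex set determines them.\<close>

lemma min_path_unique:
  fixes W :: "'a set \<Rightarrow> nat"
  assumes E: "finite E" "\<And>e. e \<in> E \<Longrightarrow> card e = 2" "\<And>e. e \<in> E \<Longrightarrow> W e > 0"
    and p: "p \<noteq> []" "distinct p" "path_edges p \<subseteq> E" "hd p = u" "last p = v"
    and q: "q \<noteq> []" "distinct q" "path_edges q \<subseteq> E" "hd q = u" "last q = v"
    and uv: "u \<noteq> v" and set_eq: "set p = set q"
    and minp: "\<And>Z. Z \<subseteq> E \<Longrightarrow> odd_verts Z = {u, v} \<Longrightarrow> sum W (path_edges p) \<le> sum W Z"
    and minq: "\<And>Z. Z \<subseteq> E \<Longrightarrow> odd_verts Z = {u, v} \<Longrightarrow> sum W (path_edges q) \<le> sum W Z"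
  shows "p = q"
proof -
  let ?d = "\<lambda>z. LEAST n. \<exists>Z\<subseteq>E. odd_verts Z = sym_diff {u} {z} \<and> n = sum W Z"
  have "sorted_wrt (\<lambda>a b. ?d a < ?d b) p"
    using min_path_sorted[of E W p, OF E p(1-3)] minp uv p by simp
  then have sp: "sorted_wrt (<) (map ?d p)" unfolding sorted_wrt_map .
  have "sorted_wrt (\<lambda>a b. ?d a < ?d b) q"
    using min_path_sorted[of E W q, OF E q(1-3)] minq uv q by simp
  then have sq: "sorted_wrt (<) (map ?d q)" unfolding sorted_wrt_map .
  have "map ?d p = map ?d q"
    by (rule strict_sorted_equal[OF sq sp]) (use set_eq in auto)
  moreover have "inj_on ?d (set p)"
    using sp unfolding strict_sorted_iff distinct_map by blast
  ultimately show ?thesis using map_inj_on[of ?d p q] set_eq by simp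
qed

subsection \<open>Lex shortest paths as lightest paths\<close>

text \<open>Three criteria are packed into one number: a set \<open>Z\<close> receives
  \<open>A * sum w Z + (card Z * B - sum g Z)\<close>, where \<open>B\<close> exceeds every sum of
  \<open>g\<close> and \<open>A\<close> exceeds every possible value of the bracket.\<close>

lemma lex_weight_exists:
  fixes w g :: "'b \<Rightarrow> nat"
  assumes "finite E"
  obtains W :: "'b \<Rightarrow> nat" where "\<And>e. e \<in> E \<Longrightarrow> W e > 0"
    and "\<And>Z Z'. Z \<subseteq> E \<Longrightarrow> Z' \<subseteq> E \<Longrightarrow> sum W Z < sum W Z' \<longleftrightarrow>
      sum w Z < sum w Z' \<or> sum w Z = sum w Z' \<and>
        (card Z < card Z' \<or> card Z = card Z' \<and> sum g Z' < sum g Z)"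
proof -
  define B where "B = Suc (sum g E)"
  \<comment> \<open>On \<open>E\<close> the subtraction is not truncated because
    \<open>g e < B\<close>; this also makes \<open>W\<close> positive.\<close>
  define h where "h e = B - g e" for e
  define A where "A = Suc (card E * B)"
  define W where "W e = A * w e + h e" for e
  have gB: "g e < B" if "e \<in> E" for e
    using member_le_sum[OF that, of g] assms by (simp add: B_def)
  have hg: "sum h Z + sum g Z = card Z * B" and gZ: "sum g Z < B" and hA: "sum h Z < A"
    if Z: "Z \<subseteq> E" for Z
  proof -
    have "sum h Z + sum g Z = (\<Sum>e\<in>Z. h e + g e)" by (simp add: sum.distrib)
    also have "\<dots> = (\<Sum>e\<in>Z. B)"
      using gB Z by (intro sum.cong) (auto simp: h_def intro!: le_add_diff_inverse2 less_imp_le)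
    finally show hg: "sum h Z + sum g Z = card Z * B" by simp
    show "sum g Z < B" using sum_mono2[OF assms Z, of g] by (simp add: B_def)
    have "card Z * B \<le> card E * B" using card_mono[OF assms Z] by (rule mult_le_mono1)
    then show "sum h Z < A" using hg unfolding A_def by linarith
  qed
  have h_less: "sum h Z < sum h Z' \<longleftrightarrow> card Z < card Z' \<or> card Z = card Z' \<and> sum g Z' < sum g Z"
    if Z: "Z \<subseteq> E" "Z' \<subseteq> E" for Z Z'
  proof -
    have *: "sum h Y < sum h Y'" if "card Y < card Y'" "Y \<subseteq> E" "Y' \<subseteq> E" for Y Y'
    proof -
      have "card Y * B + B \<le> card Y' * B" using that(1) by (metis Suc_leI add.commute mult_Suc mult_le_mono1)
      then show ?thesis using hg[OF that(2)] hg[OF that(3)] gZ[OF that(3)] by linarith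
    qed
    show ?thesis
      using *[of Z Z'] *[of Z' Z] hg[OF Z(1)] hg[OF Z(2)] Z
      by (cases "card Z" "card Z'" rule: linorder_cases) auto
  qed
  have lexi: "A * a + s < A * b + t \<longleftrightarrow> a < b \<or> a = b \<and> s < t" if "s < A" "t < A" for a b s t :: nat
  proof -
    have *: "A * a + s < A * b + t" if "a < b" "s < A" for a b s t :: nat
    proof -
      have "A * a + A \<le> A * b" using that(1) by (metis Suc_leI add.commute mult_Suc_right mult_le_mono2)
      then show ?thesis using that(2) by linarith
    qed
    show ?thesis using *[of a b s t] *[of b a t s] that
      by (cases a b rule: linorder_cases) auto
  qed
  have sumW: "sum W Z = A * sum w Z + sum h Z" for Z
    unfolding W_def by (simp add: sum.distrib sum_distrib_left)
  show ?thesis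
  proof (rule that[of W])
    show "W e > 0" if "e \<in> E" for e using gB[OF that] by (simp add: W_def h_def)
    show "sum W Z < sum W Z' \<longleftrightarrow> sum w Z < sum w Z' \<or> sum w Z = sum w Z' \<and>
        (card Z < card Z' \<or> card Z = card Z' \<and> sum g Z' < sum g Z)"
      if "Z \<subseteq> E" "Z' \<subseteq> E" for Z Z'
      unfolding sumW using lexi[OF hA hA] h_less that by simp
  qed
qed

section \<open>Encoding the vertex order by powers of two\<close>

definition greater_wrt :: "'a rel \<Rightarrow> 'a set \<Rightarrow> 'a \<Rightarrow> 'a set" where
  "greater_wrt r V m = {b\<in>V. less_wrt r m b}"

text \<open>The exponent is the rank counted from the top, so each vertex outweighs all larger
  vertices together, and a set of vertices is coded by its binary number.\<close>

definition vertex_code :: "'a rel \<Rightarrow> 'a set \<Rightarrow> 'a \<Rightarrow> nat" where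
  "vertex_code r V a = 2 ^ card (greater_wrt r V a)"

context
  fixes V :: "'a set" and r :: "'a rel"
  assumes V: "finite V" and r: "linear_order_on V r"
begin

lemma less_wrt_trans: "less_wrt r a b \<Longrightarrow> less_wrt r b c \<Longrightarrow> less_wrt r a c"
  using r unfolding less_wrt_def linear_order_on_def partial_order_on_def preorder_on_def
  by (metis antisymD transD)

lemma less_wrt_asym: "less_wrt r a b \<Longrightarrow> \<not> less_wrt r b a"
  using r unfolding less_wrt_def linear_order_on_def partial_order_on_def
  by (metis antisymD)

lemma less_wrt_linear: "a \<in> V \<Longrightarrow> b \<in> V \<Longrightarrow> a \<noteq> b \<Longrightarrow> less_wrt r a b \<or> less_wrt r b a"
  using r unfolding less_wrt_def linear_order_on_def total_on_def by metis

lemma card_greater_less: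
  assumes "less_wrt r a b" "b \<in> V"
  shows "card (greater_wrt r V b) < card (greater_wrt r V a)"
proof (rule psubset_card_mono)
  show "finite (greater_wrt r V a)" using V by (simp add: greater_wrt_def)
  have "b \<in> greater_wrt r V a" "b \<notin> greater_wrt r V b"
    using assms less_wrt_asym by (auto simp: greater_wrt_def less_wrt_def)
  moreover have "greater_wrt r V b \<subseteq> greater_wrt r V a"
    using assms less_wrt_trans by (auto simp: greater_wrt_def)
  ultimately show "greater_wrt r V b \<subset> greater_wrt r V a" by blast
qed

lemma sum_pow2_less: "(\<Sum>k<n. 2 ^ k) < (2::nat) ^ n"
  by (induction n) auto

text \<open>The exponents of the elements of \<open>S\<close> are distinct and below that of
  \<open>m\<close>, so the geometric sum bounds the left-hand side.\<close>

lemma sum_vertex_code_less: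
  assumes "S \<subseteq> greater_wrt r V m"
  shows "sum (vertex_code r V) S < vertex_code r V m"
proof -
  let ?k = "\<lambda>a. card (greater_wrt r V a)"
  have S: "S \<subseteq> V" using assms by (auto simp: greater_wrt_def)
  have "inj_on ?k S"
  proof (rule inj_onI, rule ccontr)
    fix a b assume ab: "a \<in> S" "b \<in> S" "?k a = ?k b" "a \<noteq> b"
    have V: "a \<in> V" "b \<in> V" using ab S by auto
    from less_wrt_linear[OF V ab(4)] show False
      using card_greater_less[of a b] card_greater_less[of b a] ab(3) V by auto
  qed
  then have "sum (vertex_code r V) S = (\<Sum>k\<in>?k ` S. 2 ^ k)"
    by (simp add: sum.reindex vertex_code_def)
  also have "\<dots> \<le> (\<Sum>k<?k m. 2 ^ k)"
  proof (rule sum_mono2)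
    show "?k ` S \<subseteq> {..<?k m}"
      using card_greater_less assms by (auto simp: greater_wrt_def)
  qed auto
  also have "\<dots> < 2 ^ ?k m" by (rule sum_pow2_less)
  finally show ?thesis by (simp add: vertex_code_def)
qed

lemma min_wrt:
  assumes "A \<subseteq> V" "A \<noteq> {}"
  shows "min_wrt r A \<in> A" "\<And>x. x \<in> A \<Longrightarrow> x \<noteq> min_wrt r A \<Longrightarrow> less_wrt r (min_wrt r A) x"
proof -
  have f: "finite A" using assms V finite_subset by blast
  have "\<exists>m\<in>A. \<forall>x\<in>A. (m, x) \<in> r"
    using f assms(2,1)
  proof (induction rule: finite_ne_induct)
    case (singleton x)
    then show ?case
      using r unfolding linear_order_on_def partial_order_on_def preorder_on_def refl_on_def by simp
  next
    case (insert x F)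
    then obtain m where m: "m \<in> F" "\<And>y. y \<in> F \<Longrightarrow> (m, y) \<in> r" by auto
    have xm: "x \<in> V" "m \<in> V" "x \<noteq> m" using insert m by auto
    have refl: "(x, x) \<in> r"
      using r xm unfolding linear_order_on_def partial_order_on_def preorder_on_def refl_on_def by simp
    from less_wrt_linear[OF xm] show ?case
    proof
      assume l: "less_wrt r x m"
      then have "(x, m) \<in> r" by (simp add: less_wrt_def)
      then have "(x, y) \<in> r" if "y \<in> F" for y
        using m(2)[OF that] r unfolding linear_order_on_def partial_order_on_def preorder_on_def
        by (meson transD)
      then show ?thesis using refl by auto
    next
      assume "less_wrt r m x"
      then show ?thesis using m by (auto simp: less_wrt_def)
    qed
  qed
  then obtain m where m: "m \<in> A" "\<And>x. x \<in> A \<Longrightarrow> (m, x) \<in> r" by auto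
  have "min_wrt r A = m"
    unfolding min_wrt_def
  proof (rule the_equality)
    show "m \<in> A \<and> (\<forall>x\<in>A. (m, x) \<in> r)" using m by simp
    fix k assume k: "k \<in> A \<and> (\<forall>x\<in>A. (k, x) \<in> r)"
    have "antisym r" using r unfolding linear_order_on_def partial_order_on_def by simp
    moreover have "(k, m) \<in> r" "(m, k) \<in> r" using k m by auto
    ultimately show "k = m" by (rule antisymD)
  qed
  then show "min_wrt r A \<in> A" "\<And>x. x \<in> A \<Longrightarrow> x \<noteq> min_wrt r A \<Longrightarrow> less_wrt r (min_wrt r A) x"
    using m by (auto simp: less_wrt_def)
qed

text \<open>The common part cancels, and the least element of \<open>X - Y\<close> alone outweighs
  all of \<open>Y - X\<close>.\<close>

lemma less_min_imp_sum_less: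
  assumes XY: "X \<subseteq> V" "Y \<subseteq> V" "X - Y \<noteq> {}" "Y - X \<noteq> {}"
    and l: "less_wrt r (min_wrt r (X - Y)) (min_wrt r (Y - X))"
  shows "sum (vertex_code r V) Y < sum (vertex_code r V) X"
proof -
  have f: "finite X" "finite Y" using XY V finite_subset by blast+
  have D: "X - Y \<subseteq> V" "Y - X \<subseteq> V" using XY by auto
  let ?m = "min_wrt r (X - Y)" and ?c = "vertex_code r V"
  have "Y - X \<subseteq> greater_wrt r V ?m"
  proof
    fix y assume y: "y \<in> Y - X"
    then have "y = min_wrt r (Y - X) \<or> less_wrt r (min_wrt r (Y - X)) y"
      using min_wrt(2)[OF D(2) XY(4)] by blast
    then have "less_wrt r ?m y" using l less_wrt_trans by blast
    then show "y \<in> greater_wrt r V ?m" using y D by (auto simp: greater_wrt_def)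
  qed
  then have "sum ?c (Y - X) < ?c ?m" by (rule sum_vertex_code_less)
  also have "\<dots> \<le> sum ?c (X - Y)"
    by (rule member_le_sum) (use min_wrt(1)[OF D(1) XY(3)] f in auto)
  finally have "sum ?c (Y - X) < sum ?c (X - Y)" .
  moreover have "sum ?c Y = sum ?c (Y \<inter> X) + sum ?c (Y - X)" by (rule sum.Int_Diff[OF f(2)])
  moreover have "sum ?c X = sum ?c (X \<inter> Y) + sum ?c (X - Y)" by (rule sum.Int_Diff[OF f(1)])
  ultimately show ?thesis by (simp add: Int_commute)
qed

text \<open>Equal cardinalities make both differences empty or both nonempty. If empty, the two
  minima are the same unspecified element and both sides are false; otherwise the minima are
  distinct and one of the two directions applies.\<close>

lemma less_min_iff_sum_less:
  assumes XY: "X \<subseteq> V" "Y \<subseteq> V" "card X = card Y"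
  shows "less_wrt r (min_wrt r (X - Y)) (min_wrt r (Y - X)) \<longleftrightarrow>
    sum (vertex_code r V) Y < sum (vertex_code r V) X"
proof (cases "X = Y")
  case True
  then show ?thesis by (simp add: less_wrt_def)
next
  case False
  have f: "finite X" "finite Y" using XY V finite_subset by blast+
  have ne: "X - Y \<noteq> {}" "Y - X \<noteq> {}"
    using False card_subset_eq[OF f(1), of Y] card_subset_eq[OF f(2), of X] XY(3) by auto
  have D: "X - Y \<subseteq> V" "Y - X \<subseteq> V" using XY by auto
  have m: "min_wrt r (X - Y) \<in> X - Y" "min_wrt r (Y - X) \<in> Y - X"
    using min_wrt(1) D ne by auto
  then have "min_wrt r (X - Y) \<noteq> min_wrt r (Y - X)" by auto
  then have "less_wrt r (min_wrt r (X - Y)) (min_wrt r (Y - X)) \<or>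
      less_wrt r (min_wrt r (Y - X)) (min_wrt r (X - Y))"
    using less_wrt_linear m D by blast
  then show ?thesis
    using less_min_imp_sum_less[OF XY(1,2) ne] less_min_imp_sum_less[OF XY(2,1) ne(2,1)]
      less_wrt_asym by auto
qed

lemma sum_vertex_code_eq:
  assumes XY: "X \<subseteq> V" "Y \<subseteq> V" "card X = card Y"
    and eq: "sum (vertex_code r V) X = sum (vertex_code r V) Y"
  shows "X = Y"
proof (rule ccontr)
  assume ne: "X \<noteq> Y"
  have f: "finite X" "finite Y" using XY V finite_subset by blast+
  have ne: "X - Y \<noteq> {}" "Y - X \<noteq> {}"
    using ne card_subset_eq[OF f(1), of Y] card_subset_eq[OF f(2), of X] XY(3) by auto
  have D: "X - Y \<subseteq> V" "Y - X \<subseteq> V" using XY by auto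
  have m: "min_wrt r (X - Y) \<in> X - Y" "min_wrt r (Y - X) \<in> Y - X"
    using min_wrt(1) D ne by auto
  then have "min_wrt r (X - Y) \<noteq> min_wrt r (Y - X)" by auto
  then have "less_wrt r (min_wrt r (X - Y)) (min_wrt r (Y - X)) \<or>
      less_wrt r (min_wrt r (Y - X)) (min_wrt r (X - Y))"
    using less_wrt_linear m D by blast
  then show False
    using less_min_imp_sum_less[OF XY(1,2) ne] less_min_imp_sum_less[OF XY(2,1) ne(2,1)] eq by auto
qed

end

text \<open>An inner vertex meets two path edges and an end meets one. For fixed ends this turns a
  comparison of vertex sums into one of edge sums.\<close>

lemma sum_path_edges:
  fixes c :: "'a \<Rightarrow> nat"
  shows "distinct p \<Longrightarrow> p \<noteq> [] \<Longrightarrow>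
    (\<Sum>e\<in>path_edges p. sum c e) + c (hd p) + c (last p) = 2 * sum c (set p)"
proof (induction p rule: induct_list012)
  case (3 x y zs)
  have "{x, y} \<notin> path_edges (y # zs)" using Cons_notin_path_edges[of x "y # zs"] 3(3) by simp
  then have "(\<Sum>e\<in>path_edges (x # y # zs). sum c e) = c x + c y + (\<Sum>e\<in>path_edges (y # zs). sum c e)"
    using 3(3) by simp
  moreover have "(\<Sum>e\<in>path_edges (y # zs). sum c e) + c y + c (last (y # zs)) = 2 * sum c (set (y # zs))"
    using 3 by simp
  ultimately show ?case using 3(3) by simp
qed auto

lemma card_path_edges: "distinct p \<Longrightarrow> p \<noteq> [] \<Longrightarrow> card (path_edges p) + 1 = card (set p)"
proof (induction p rule: induct_list012)
  case (3 x y zs)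
  have "{x, y} \<notin> path_edges (y # zs)" using Cons_notin_path_edges[of x "y # zs"] 3(3) by simp
  then show ?case using 3 by simp
qed auto

text \<open>
  The sum of the vertex codes over the edges of a path is twice the sum over its vertices minus the codes
  of its ends. Smaller vertices have larger codes, hence the reversed last comparison.
\<close>

locale lex_weighted =
  fixes G :: "'a ugraph" and w :: "'a set \<Rightarrow> nat" and r :: "'a rel" and W :: "'a set \<Rightarrow> nat"
  assumes simple: "simple_graph G" and finV: "finite (verts G)"
    and order: "linear_order_on (verts G) r"
    and W_pos: "\<And>e. e \<in> edges G \<Longrightarrow> W e > 0"
    and W_less: "\<And>Z Z'. Z \<subseteq> edges G \<Longrightarrow> Z' \<subseteq> edges G \<Longrightarrow> sum W Z < sum W Z' \<longleftrightarrow>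
      sum w Z < sum w Z' \<or> sum w Z = sum w Z' \<and> (card Z < card Z' \<or> card Z = card Z' \<and>
        (\<Sum>e\<in>Z'. sum (vertex_code r (verts G)) e) < (\<Sum>e\<in>Z. sum (vertex_code r (verts G)) e))"
begin

lemma card_edge: "e \<in> edges G \<Longrightarrow> card e = 2"
  and edge_subset: "e \<in> edges G \<Longrightarrow> e \<subseteq> verts G"
  using simple unfolding simple_graph_def by auto

lemma finE: "finite (edges G)"
  using finite_subset[of "edges G" "Pow (verts G)"] finV edge_subset by auto

lemma sum_W_less_subset:
  assumes "Z \<subset> Z'" "Z' \<subseteq> edges G"
  shows "sum W Z < sum W Z'"
proof -
  have f: "finite Z'" using assms finE finite_subset by blast
  obtain e where e: "e \<in> Z' - Z" using assms by auto
  then have "0 < W e" using W_pos[of e] assms(2) by blast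
  then show ?thesis using sum_strict_mono2[OF f _ e, of W] assms(1) by blast
qed

text \<open>The right-hand side is the comparison used in \<open>is_lsp\<close>. As the ends agree,
  the edge sums of the codes compare like the vertex sums; equality of \<open>W\<close> forces equal
  code sums and cardinalities, hence equal vertex sets.\<close>

lemma path_W_less:
  assumes p: "p \<noteq> []" "distinct p" "set p \<subseteq> verts G" "path_edges p \<subseteq> edges G"
    and q: "q \<noteq> []" "distinct q" "set q \<subseteq> verts G" "path_edges q \<subseteq> edges G"
    and ends: "hd p = hd q" "last p = last q"
  shows "sum W (path_edges p) < sum W (path_edges q) \<longleftrightarrow>
      weight w (walk_graph q) > weight w (walk_graph p)
      \<or> (weight w (walk_graph q) = weight w (walk_graph p) \<and> card (path_edges q) > card (path_edges p))
      \<or> (weight w (walk_graph q) = weight w (walk_graph p) \<and> card (path_edges q) = card (path_edges p) \<and>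
          less_wrt r (min_wrt r (verts (walk_graph p) - verts (walk_graph q)))
            (min_wrt r (verts (walk_graph q) - verts (walk_graph p))))"
    and "sum W (path_edges p) = sum W (path_edges q) \<Longrightarrow> set p = set q"
proof -
  let ?c = "vertex_code r (verts G)"
  have c: "(\<Sum>e\<in>path_edges q. sum ?c e) < (\<Sum>e\<in>path_edges p. sum ?c e) \<longleftrightarrow>
      sum ?c (set q) < sum ?c (set p)"
    using sum_path_edges[OF p(2,1), of ?c] sum_path_edges[OF q(2,1), of ?c] ends by simp linarith
  have c': "(\<Sum>e\<in>path_edges p. sum ?c e) < (\<Sum>e\<in>path_edges q. sum ?c e) \<longleftrightarrow>
      sum ?c (set p) < sum ?c (set q)"
    using sum_path_edges[OF p(2,1), of ?c] sum_path_edges[OF q(2,1), of ?c] ends by simp linarith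
  have k: "card (set p) = card (set q)" if "card (path_edges q) = card (path_edges p)"
    using card_path_edges[OF p(2,1)] card_path_edges[OF q(2,1)] that by simp
  show "sum W (path_edges p) < sum W (path_edges q) \<longleftrightarrow>
      weight w (walk_graph q) > weight w (walk_graph p)
      \<or> (weight w (walk_graph q) = weight w (walk_graph p) \<and> card (path_edges q) > card (path_edges p))
      \<or> (weight w (walk_graph q) = weight w (walk_graph p) \<and> card (path_edges q) = card (path_edges p) \<and>
          less_wrt r (min_wrt r (verts (walk_graph p) - verts (walk_graph q)))
            (min_wrt r (verts (walk_graph q) - verts (walk_graph p))))"
    unfolding W_less[OF p(4) q(4)] c weight_def verts_walk_graph
    using less_min_iff_sum_less[OF finV order p(3) q(3) k] by auto
  assume eq: "sum W (path_edges p) = sum W (path_edges q)"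
  have "\<not> sum W (path_edges p) < sum W (path_edges q)" "\<not> sum W (path_edges q) < sum W (path_edges p)"
    using eq by simp_all
  then have "card (path_edges q) = card (path_edges p)" "sum ?c (set p) = sum ?c (set q)"
    unfolding W_less[OF p(4) q(4)] W_less[OF q(4) p(4)] c c' by linarith+
  then show "set p = set q" using sum_vertex_code_eq[OF finV order p(3) q(3) k] by simp
qed

text \<open>\<open>Z0\<close> supplies a path, and since every \<open>u\<close>-\<open>v\<close> set
  contains a path, a lightest path is lightest among all such sets. A tie between paths would give
  equal vertex sets by \<open>path_W_less\<close> and then equal paths by
  \<open>min_path_unique\<close>.\<close>

lemma lsp_minimal:
  assumes uv: "u \<noteq> v" and Z0: "Z0 \<subseteq> edges G" "odd_verts Z0 = {u, v}"
  shows "edges (lsp G w r u v) \<subseteq> edges G" "odd_verts (edges (lsp G w r u v)) = {u, v}"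
    and "verts (lsp G w r u v) \<subseteq> \<Union>(edges (lsp G w r u v))"
    and "\<And>Z. Z \<subseteq> edges G \<Longrightarrow> odd_verts Z = {u, v} \<Longrightarrow>
      Z = edges (lsp G w r u v) \<or> sum W (edges (lsp G w r u v)) < sum W Z"
proof -
  define paths where
    "paths = {p. p \<noteq> [] \<and> hd p = u \<and> last p = v \<and> distinct p \<and> path_edges p \<subseteq> edges G}"
  have ex: "\<exists>p\<in>paths. path_edges p \<subseteq> Z" if Z: "Z \<subseteq> edges G" "odd_verts Z = {u, v}" for Z
  proof -
    have "finite Z" using Z finE finite_subset by blast
    moreover have "card e = 2" if "e \<in> Z" for e using that Z card_edge by blast
    ultimately obtain p where "p \<noteq> []" "hd p = u" "last p = v" "distinct p" "path_edges p \<subseteq> Z"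
      using odd_verts_contains_path[OF _ _ Z(2) uv] by blast
    then show ?thesis using Z unfolding paths_def by blast
  qed
  have len: "length p \<ge> 2" if p: "p \<in> paths" for p
  proof -
    obtain a q where "p = a # q" using p unfolding paths_def by (cases p) auto
    then show ?thesis using p uv unfolding paths_def by (cases q) auto
  qed
  have sub: "set p \<subseteq> \<Union>(path_edges p)" if "p \<in> paths" for p
    by (rule set_subset_path_edges[OF len[OF that]])
  have vs: "set p \<subseteq> verts G" if "p \<in> paths" for p
    using sub[OF that] that edge_subset unfolding paths_def by blast
  have is_path: "is_path G u v P \<longleftrightarrow> (\<exists>p\<in>paths. P = walk_graph p)" for P
  proof
    assume "is_path G u v P"
    then show "\<exists>p\<in>paths. P = walk_graph p" unfolding is_path_def paths_def subgraph_def by blast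
  next
    assume "\<exists>p\<in>paths. P = walk_graph p"
    then obtain p where p: "p \<in> paths" "P = walk_graph p" by blast
    then have "subgraph P G" using vs[OF p(1)] unfolding subgraph_def paths_def by simp
    then show "is_path G u v P" using p unfolding is_path_def paths_def by blast
  qed
  obtain p0 where p0: "p0 \<in> paths" using ex[OF Z0] by blast
  obtain p where p: "p \<in> paths" and pmin: "\<And>q. q \<in> paths \<Longrightarrow> sum W (path_edges p) \<le> sum W (path_edges q)"
    using ex_has_least_nat[of "\<lambda>p. p \<in> paths" p0 "\<lambda>p. sum W (path_edges p)"] p0 by blast
  have minZ: "sum W (path_edges p) \<le> sum W Z" if Z: "Z \<subseteq> edges G" "odd_verts Z = {u, v}" for Z
  proof -
    obtain q where q: "q \<in> paths" "path_edges q \<subseteq> Z" using ex[OF Z] by blast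
    have "finite Z" using Z finE finite_subset by blast
    then have "sum W (path_edges q) \<le> sum W Z" using q(2) by (intro sum_mono2) auto
    then show ?thesis using pmin[OF q(1)] by simp
  qed
  have P: "q \<noteq> []" "hd q = u" "last q = v" "distinct q" "path_edges q \<subseteq> edges G" "set q \<subseteq> verts G"
    if "q \<in> paths" for q
    using that vs unfolding paths_def by auto
  have strict: "sum W (path_edges p) < sum W (path_edges q)" if q: "q \<in> paths" "q \<noteq> p" for q
  proof (rule ccontr)
    assume "\<not> ?thesis"
    then have eq: "sum W (path_edges p) = sum W (path_edges q)" using pmin[OF q(1)] by simp
    have "set p = set q"
      by (rule path_W_less(2)[OF _ _ _ _ _ _ _ _ _ _ eq]) (use P[OF p] P[OF q(1)] in simp_all)
    then have "p = q"
      by (intro min_path_unique[of "edges G" W p u v q, OF finE card_edge W_pos])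
        (use P[OF p] P[OF q(1)] uv minZ eq in simp_all)
    then show False using q by simp
  qed
  have lsp: "lsp G w r u v = walk_graph p"
    unfolding lsp_def
  proof (rule the_equality)
    show "is_lsp G w r u v (walk_graph p)"
      unfolding is_lsp_def
    proof (intro conjI allI impI)
      show "is_path G u v (walk_graph p)" using is_path p by blast
      fix P' assume P': "is_path G u v P' \<and> P' \<noteq> walk_graph p"
      then obtain q where q: "q \<in> paths" "P' = walk_graph q" "q \<noteq> p" using is_path by blast
      have "sum W (path_edges p) < sum W (path_edges q)" by (rule strict[OF q(1,3)])
      then show "weight w P' > weight w (walk_graph p)
      \<or> (weight w P' = weight w (walk_graph p) \<and> card (edges P') > card (path_edges p))
      \<or> (weight w P' = weight w (walk_graph p) \<and> card (edges P') = card (path_edges p) \<and>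
          less_wrt r (min_wrt r (verts (walk_graph p) - verts P')) (min_wrt r (verts P' - verts (walk_graph p))))"
        unfolding q(2) by (subst path_W_less(1)[symmetric]) (use P[OF p] P[OF q(1)] in simp_all)
    qed
  next
    fix Q assume Q: "is_lsp G w r u v Q"
    then obtain q where q: "q \<in> paths" "Q = walk_graph q" using is_path unfolding is_lsp_def by blast
    show "Q = walk_graph p"
    proof (rule ccontr)
      assume ne: "Q \<noteq> walk_graph p"
      have "is_path G u v (walk_graph p)" using is_path p by blast
      then have "weight w (walk_graph p) > weight w Q
      \<or> (weight w (walk_graph p) = weight w Q \<and> card (path_edges p) > card (edges Q))
      \<or> (weight w (walk_graph p) = weight w Q \<and> card (path_edges p) = card (edges Q) \<and>
          less_wrt r (min_wrt r (verts Q - verts (walk_graph p))) (min_wrt r (verts (walk_graph p) - verts Q)))"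
        using Q ne unfolding is_lsp_def by metis
      \<comment> \<open>A second path with the defining property would be strictly lighter than the
        lightest one.\<close>
      then have "sum W (path_edges q) < sum W (path_edges p)"
        unfolding q(2) by (subst path_W_less(1)) (use P[OF p] P[OF q(1)] in simp_all)
      then show False using pmin[OF q(1)] by simp
    qed
  qed
  show "edges (lsp G w r u v) \<subseteq> edges G" using lsp P[OF p] by simp
  show "odd_verts (edges (lsp G w r u v)) = {u, v}"
    using lsp odd_verts_path[of p] P[OF p] uv by auto
  show "verts (lsp G w r u v) \<subseteq> \<Union>(edges (lsp G w r u v))" using lsp sub[OF p] by simp
  fix Z assume Z: "Z \<subseteq> edges G" "odd_verts Z = {u, v}"
  obtain q where q: "q \<in> paths" "path_edges q \<subseteq> Z" using ex[OF Z] by blast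
  show "Z = edges (lsp G w r u v) \<or> sum W (edges (lsp G w r u v)) < sum W Z"
  proof (cases "path_edges q = Z")
    case True
    then show ?thesis using strict[OF q(1)] lsp by (cases "q = p") auto
  next
    case False
    then have "sum W (path_edges q) < sum W Z" using sum_W_less_subset q Z by blast
    then show ?thesis using pmin[OF q(1)] lsp by simp
  qed
qed

end

subsection \<open>Span and minimality\<close>

interpretation F2: vector_space scale_F2
  by (rule vector_space_scale_F2)

definition ind :: "'a set set \<Rightarrow> 'a set \<Rightarrow> bit" where
  "ind Z = (\<lambda>e. if e \<in> Z then 1 else 0)"

lemma incidence_vector_eq: "incidence_vector C = ind (edges C)"
  by (simp add: incidence_vector_def ind_def)

lemma inj_ind: "inj ind"
proof (rule injI)
  fix A B :: "'a set set" assume "ind A = ind B"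
  then have "e \<in> A \<longleftrightarrow> e \<in> B" for e by (metis ind_def zero_neq_one)
  then show "A = B" by blast
qed

lemma ind_sym_diff: "ind (sym_diff A B) = ind A + ind B"
  by (auto simp: ind_def fun_eq_iff)

lemma ind_empty: "ind {} = 0"
  by (simp add: ind_def fun_eq_iff)

text \<open>The members with nonzero coefficient in a linear dependence form a family that covers
  every edge an even number of times.\<close>

lemma independent_ind:
  assumes "F2_indep T"
  shows "\<not> F2.dependent (ind ` T)"
proof
  assume "F2.dependent (ind ` T)"
  then obtain S u where S: "finite S" "S \<subseteq> ind ` T" "\<exists>v\<in>S. u v \<noteq> 0"
    and sum0: "(\<Sum>v\<in>S. scale_F2 (u v) v) = 0"
    unfolding F2.dependent_explicit by blast
  define F where "F = {Z\<in>T. ind Z \<in> S \<and> u (ind Z) \<noteq> 0}"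
  have indF: "ind ` F = {v\<in>S. u v \<noteq> 0}" using S(2) by (auto simp: F_def)
  have inj: "inj_on ind F" using inj_ind inj_on_subset by blast
  have "finite (ind ` F)" using S(1) indF by simp
  then have finF: "finite F" using finite_image_iff[OF inj] by simp
  have "even (card {Z\<in>F. e \<in> Z})" for e
  proof -
    have apply_sum: "(\<Sum>v\<in>S. f v) e = (\<Sum>v\<in>S. f v e)" for f :: "('a set \<Rightarrow> bit) \<Rightarrow> 'a set \<Rightarrow> bit"
      using S(1) by (induction S rule: finite_induct) simp_all
    have "0 = (\<Sum>v\<in>S. scale_F2 (u v) v) e" using sum0 by simp
    also have "\<dots> = (\<Sum>v\<in>S. u v * v e)" unfolding apply_sum scale_F2_def ..
    \<comment> \<open>A nonzero coefficient in \<open>bit\<close> is 1, so only the support of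
      \<open>u\<close> has to be recorded.\<close>
    also have "\<dots> = (\<Sum>v\<in>{v\<in>S. u v \<noteq> 0}. v e)"
      by (rule sum.mono_neutral_cong_right) (use S(1) in auto)
    also have "\<dots> = (\<Sum>Z\<in>F. ind Z e)"
      unfolding indF[symmetric] using inj by (simp add: sum.reindex)
    also have "\<dots> = (\<Sum>Z\<in>{Z\<in>F. e \<in> Z}. 1)"
      by (rule sum.mono_neutral_cong_right) (use finF in \<open>auto simp: ind_def\<close>)
    finally have "of_nat (card {Z\<in>F. e \<in> Z}) = (0 :: bit)" by simp
    then show ?thesis by (cases "even (card {Z\<in>F. e \<in> Z})") (auto elim!: oddE)
  qed
  moreover have "F \<subseteq> T" by (auto simp: F_def)
  ultimately have "F = {}" using F2_indepD[OF assms _ finF] by blast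
  then show False using indF S(3) by blast
qed

text \<open>Layer-cake summation: \<open>sum f X\<close> counts, over all thresholds
  \<open>t\<close>, the elements with \<open>f\<close> above \<open>t\<close>. As the cardinalities
  agree, the bound on the elements up to \<open>t\<close> reverses for those above
  \<open>t\<close>.\<close>

lemma sum_le_if_card_le:
  fixes f :: "'b \<Rightarrow> nat"
  assumes fin: "finite A" "finite B" and card: "card A = card B"
    and le: "\<And>t. card {b\<in>B. f b \<le> t} \<le> card {a\<in>A. f a \<le> t}"
  shows "sum f A \<le> sum f B"
proof -
  define M where "M = sum f A + sum f B"
  have layers: "sum f X = (\<Sum>t<M. card {x\<in>X. t < f x})"
    if X: "finite X" "\<And>x. x \<in> X \<Longrightarrow> f x \<le> M" for X
  proof -
    have "f x = (\<Sum>t<M. if t < f x then 1 else 0)" if "x \<in> X" for x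
    proof -
      have "{t. t < M \<and> t < f x} = {..<f x}" using X(2)[OF that] by auto
      then show ?thesis by (simp add: sum.If_cases Int_def)
    qed
    then have "sum f X = (\<Sum>x\<in>X. \<Sum>t<M. if t < f x then 1 else 0)" by (rule sum.cong[OF refl])
    also have "\<dots> = (\<Sum>t<M. \<Sum>x\<in>X. if t < f x then 1 else 0)" by (rule sum.swap)
    also have "\<dots> = (\<Sum>t<M. card {x\<in>X. t < f x})"
      using X(1) by (intro sum.cong) (simp_all add: sum.If_cases Int_def)
    finally show ?thesis .
  qed
  have split: "card X = card {x\<in>X. f x \<le> t} + card {x\<in>X. t < f x}" if "finite X" for X t
  proof -
    have "X = {x\<in>X. f x \<le> t} \<union> {x\<in>X. t < f x}" by auto
    then show ?thesis using that by (metis (no_types, lifting) card_Un_disjoint disjoint_iff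
        finite_Un linorder_not_le mem_Collect_eq)
  qed
  have "card {a\<in>A. t < f a} \<le> card {b\<in>B. t < f b}" for t
    using split[OF fin(1), of t] split[OF fin(2), of t] le[of t] card by linarith
  then have "(\<Sum>t<M. card {a\<in>A. t < f a}) \<le> (\<Sum>t<M. card {b\<in>B. t < f b})"
    by (intro sum_mono)
  moreover have "f a \<le> M" if "a \<in> A" for a
    using member_le_sum[OF that, of f] fin(1) by (simp add: M_def)
  moreover have "f b \<le> M" if "b \<in> B" for b
    using member_le_sum[OF that, of f] fin(2) by (simp add: M_def)
  ultimately show ?thesis using layers[OF fin(1)] layers[OF fin(2)] by simp
qed

section \<open>Lex short cycles and the cycle space of \<open>G\<close>\<close>

context lex_weighted
begin

lemma cycle_props:
  assumes "is_cycle G C"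
  shows "edges C \<subseteq> edges G" "min_even (edges C)" "verts C = \<Union>(edges C)"
    and "\<And>x y. x \<in> verts C \<Longrightarrow> y \<in> verts C \<Longrightarrow> \<exists>Q\<subseteq>edges C. odd_verts Q = sym_diff {x} {y}"
proof -
  obtain p where p: "length p \<ge> 3" "distinct p" "C = walk_graph (p @ [hd p])" and sub: "subgraph C G"
    using assms unfolding is_cycle_def by blast
  show "edges C \<subseteq> edges G" using sub unfolding subgraph_def by simp
  show "min_even (edges C)" using min_even_cycle p by simp
  have "set (p @ [hd p]) \<subseteq> \<Union>(edges C)"
    unfolding p(3) by (rule set_subset_path_edges) (use p(1) in simp)
  moreover have "\<Union>(edges C) \<subseteq> set (p @ [hd p])"
    unfolding p(3) using path_edges_subset_set by (intro Union_least)
  ultimately show "verts C = \<Union>(edges C)"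
    unfolding p(3) verts_walk_graph by (rule subset_antisym)
  have "verts C = set p" using p by (cases p) auto
  moreover have "path_edges p \<subseteq> edges C" using cycle_edges(1)[OF p(1,2)] p(3) by auto
  ultimately show "\<exists>Q\<subseteq>edges C. odd_verts Q = sym_diff {x} {y}"
    if xy: "x \<in> verts C" "y \<in> verts C" for x y
  proof -
    obtain Q where "Q \<subseteq> path_edges p" "odd_verts Q = sym_diff {x} {y}"
      using path_arc[OF p(2), of x y] xy \<open>verts C = set p\<close> by blast
    then show ?thesis using \<open>path_edges p \<subseteq> edges C\<close> by (intro exI[of _ Q]) simp
  qed
qed

lemma inj_edges_cycles: "inj_on edges {C. is_cycle G C}"
proof (rule inj_onI)
  fix C C' assume "C \<in> {C. is_cycle G C}" "C' \<in> {C. is_cycle G C}" "edges C = edges C'"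
  then show "C = C'" using cycle_props(3)[of C] cycle_props(3)[of C'] by (simp add: ugraph.equality)
qed

lemma inj_incidence_cycles: "inj_on incidence_vector {C. is_cycle G C}"
proof -
  have "incidence_vector = ind \<circ> edges" by (simp add: fun_eq_iff incidence_vector_eq)
  then show ?thesis
    using inj_edges_cycles inj_ind comp_inj_on inj_on_subset by (metis subset_UNIV)
qed

lemma finite_cycles: "finite {C. is_cycle G C}"
proof -
  have "edges ` {C. is_cycle G C} \<subseteq> Pow (edges G)" using cycle_props(1) by auto
  then have "finite (edges ` {C. is_cycle G C})" using finE finite_subset by blast
  then show ?thesis using finite_image_iff[OF inj_edges_cycles] by simp
qed

text \<open>A competitor \<open>Z\<close> either equals the lex shortest path, which lies in
  \<open>C\<close>, or is strictly heavier than that path, which then serves as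
  \<open>Z'\<close>.\<close>

lemma lex_short_imp_short_in:
  assumes "lex_short_cycle G w r C"
  shows "short_in (edges G) W (edges C)"
proof -
  have C: "is_cycle G C"
    and l: "\<And>x y. x \<in> verts C \<Longrightarrow> y \<in> verts C \<Longrightarrow> x \<noteq> y \<Longrightarrow> subgraph (lsp G w r x y) C"
    using assms unfolding lex_short_cycle_def by auto
  note c = cycle_props[OF C]
  have "Z \<subseteq> edges C \<or> (\<exists>Z'\<subseteq>edges C. odd_verts Z' = {x, y} \<and> sum W Z' < sum W Z)"
    if xy: "x \<in> \<Union>(edges C)" "y \<in> \<Union>(edges C)" "x \<noteq> y" and Z: "Z \<subseteq> edges G" "odd_verts Z = {x, y}"
    for x y Z
  proof -
    have "subgraph (lsp G w r x y) C" using l xy c(3) by simp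
    then have "edges (lsp G w r x y) \<subseteq> edges C" by (simp add: subgraph_def)
    then show ?thesis using lsp_minimal(2,4)[OF xy(3) Z] Z by metis
  qed
  then show ?thesis unfolding short_in_def using c by simp
qed

lemma nonshort_split:
  assumes C: "is_cycle G C" and "\<not> lex_short_cycle G w r C"
  obtains A B where "A \<subseteq> edges G" "B \<subseteq> edges G" "odd_verts A = {}" "odd_verts B = {}"
    "edges C = sym_diff A B" "sum W A < sum W (edges C)" "sum W B < sum W (edges C)"
proof -
  note c = cycle_props[OF C]
  obtain x y where xy: "x \<in> verts C" "y \<in> verts C" "x \<noteq> y" "\<not> subgraph (lsp G w r x y) C"
    using assms unfolding lex_short_cycle_def by blast
  obtain Q where Q: "Q \<subseteq> edges C" "odd_verts Q = {x, y}"
  proof -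
    have "sym_diff {x} {y} = {x, y}" using xy(3) by auto
    then show ?thesis using that c(4)[OF xy(1,2)] by auto
  qed
  have QG: "Q \<subseteq> edges G" "edges C - Q \<subseteq> edges G" using Q c by auto
  have f: "finite (edges C)" "finite Q" "finite (edges C - Q)"
    using finite_subset[OF _ finE] c(1) QG by blast+
  have oddC: "odd_verts (edges C) = {}" using c(2) unfolding min_even_def by simp
  have oddR: "odd_verts (edges C - Q) = {x, y}"
    using odd_verts_Diff[OF f(1) Q(1)] oddC Q(2) by simp
  let ?P = "edges (lsp G w r x y)"
  note l = lsp_minimal[OF xy(3) QG(1) Q(2)]
  \<comment> \<open>\<open>subgraph\<close> also asks for vertices, but those of the path are
    covered by its edges, so the failure must occur on an edge.\<close>
  have nsub: "\<not> ?P \<subseteq> edges C"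
  proof
    assume *: "?P \<subseteq> edges C"
    then have "verts (lsp G w r x y) \<subseteq> verts C" unfolding c(3) using l(3) by blast
    then show False using * xy(4) by (simp add: subgraph_def)
  qed
  have fP: "finite ?P" using l(1) finE finite_subset by blast
  \<comment> \<open>As \<open>?P\<close> leaves \<open>C\<close>, it equals neither arc and is
    strictly lighter than both; replacing either arc by it therefore lightens the cycle.\<close>
  have lt: "sum W ?P < sum W Q" "sum W ?P < sum W (edges C - Q)"
    using l(4)[OF QG(1) Q(2)] l(4)[OF QG(2) oddR] nsub Q(1) by auto
  have total: "sum W (edges C) = sum W (edges C - Q) + sum W Q"
    by (rule sum.subset_diff[OF Q(1) f(1)])
  show thesis
  proof (rule that[of "sym_diff Q ?P" "sym_diff (edges C - Q) ?P"])
    show "sym_diff Q ?P \<subseteq> edges G" "sym_diff (edges C - Q) ?P \<subseteq> edges G" using QG l(1) by auto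
    show "odd_verts (sym_diff Q ?P) = {}"
      using odd_verts_sym_diff[OF f(2) fP] Q(2) l(2) by simp
    show "odd_verts (sym_diff (edges C - Q) ?P) = {}"
      using odd_verts_sym_diff[OF f(3) fP] oddR l(2) by simp
    show "edges C = sym_diff (sym_diff Q ?P) (sym_diff (edges C - Q) ?P)" using Q(1) by auto
    show "sum W (sym_diff Q ?P) < sum W (edges C)"
      using sum_sym_diff_le[OF f(2) fP, of W] lt total by linarith
    show "sum W (sym_diff (edges C - Q) ?P) < sum W (edges C)"
      using sum_sym_diff_le[OF f(3) fP, of W] lt total by linarith
  qed
qed

text \<open>Induction on the weight: an even set that is not a cycle splits off a cycle, and a cycle
  that is not lex short splits by \<open>nonshort_split\<close>; the pieces are lighter in both
  cases. The bound on the generators serves the minimality argument.\<close>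

lemma even_in_span_short:
  assumes "Z \<subseteq> edges G" "odd_verts Z = {}"
  shows "ind Z \<in> F2.span (incidence_vector ` {C. lex_short_cycle G w r C \<and> sum W (edges C) \<le> sum W Z})"
  using assms
proof (induction "sum W Z" arbitrary: Z rule: less_induct)
  case less
  let ?S = "\<lambda>Z. incidence_vector ` {C. lex_short_cycle G w r C \<and> sum W (edges C) \<le> sum W Z}"
  have combine: "ind Z \<in> F2.span (?S Z)"
    if AB: "A \<subseteq> edges G" "B \<subseteq> edges G" "odd_verts A = {}" "odd_verts B = {}"
      "Z = sym_diff A B" "sum W A < sum W Z" "sum W B < sum W Z" for A B
  proof -
    have "?S A \<subseteq> ?S Z" "?S B \<subseteq> ?S Z" using AB(6,7) by auto
    then have "ind A \<in> F2.span (?S Z)" "ind B \<in> F2.span (?S Z)"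
      using less.hyps[OF AB(6,1,3)] less.hyps[OF AB(7,2,4)] F2.span_mono by blast+
    then show ?thesis unfolding AB(5) ind_sym_diff by (rule F2.span_add)
  qed
  show ?case
  proof (cases "Z = {}")
    case True
    then show ?thesis by (simp add: ind_empty F2.span_zero)
  next
    case False
    have fZ: "finite Z" using less.prems finE finite_subset by blast
    obtain p where p: "length p \<ge> 3" "distinct p" "path_edges (p @ [hd p]) \<subseteq> Z"
      using even_contains_cycle[OF fZ _ less.prems(2) False] card_edge less.prems(1) by blast
    define C where "C = walk_graph (p @ [hd p])"
    have CZ: "edges C \<subseteq> Z" using p by (simp add: C_def)
    have "verts C \<subseteq> \<Union>(edges C)"
      unfolding C_def verts_walk_graph by (rule set_subset_path_edges) (use p(1) in simp)
    also have "\<dots> \<subseteq> verts G" using CZ less.prems(1) edge_subset by blast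
    finally have "subgraph C G" using CZ less.prems(1) by (auto simp: subgraph_def)
    then have C: "is_cycle G C" unfolding is_cycle_def using p C_def by blast
    have oddC: "odd_verts (edges C) = {}" and neC: "edges C \<noteq> {}"
      using cycle_props(2)[OF C] unfolding min_even_def by simp_all
    show ?thesis
    proof (cases "edges C = Z")
      case False
      show ?thesis
      proof (rule combine[of "edges C" "Z - edges C"])
        show "odd_verts (Z - edges C) = {}"
          using odd_verts_Diff[OF fZ CZ] oddC less.prems(2) by simp
        show "Z = sym_diff (edges C) (Z - edges C)" using CZ by blast
        show "sum W (edges C) < sum W Z"
          using sum_W_less_subset CZ False less.prems(1) by blast
        show "sum W (Z - edges C) < sum W Z"
          using sum_W_less_subset[of "Z - edges C" Z] CZ neC less.prems(1) by blast
      qed (use CZ less.prems oddC in auto)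
    next
      case True
      show ?thesis
      proof (cases "lex_short_cycle G w r C")
        case short: True
        have "ind Z = incidence_vector C" using True by (simp add: incidence_vector_eq)
        then show ?thesis using short True by (intro F2.span_base) auto
      next
        case False
        then obtain A B where "A \<subseteq> edges G" "B \<subseteq> edges G" "odd_verts A = {}" "odd_verts B = {}"
          "edges C = sym_diff A B" "sum W A < sum W (edges C)" "sum W B < sum W (edges C)"
          using nonshort_split[OF C] by blast
        then show ?thesis unfolding True by (rule combine)
      qed
    qed
  qed
qed

lemma lex_short_minimum_cycle_basis:
  assumes "partial_two_tree G"
  shows "minimum_cycle_basis G w {C. lex_short_cycle G w r C}"
proof -
  let ?S = "{C. lex_short_cycle G w r C}" and ?cyc = "{C. is_cycle G C}"
  have S: "?S \<subseteq> ?cyc" by (auto simp: lex_short_cycle_def)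
  have fin: "finite B" and inj: "inj_on incidence_vector B" if "B \<subseteq> ?cyc" for B
    using that finite_cycles finite_subset inj_incidence_cycles inj_on_subset by blast+
  have cyc_span: "incidence_vector C \<in>
      F2.span (incidence_vector ` {C'. lex_short_cycle G w r C' \<and> sum W (edges C') \<le> sum W (edges C)})"
    if C: "is_cycle G C" for C
    using even_in_span_short[of "edges C"] cycle_props(1,2)[OF C]
    unfolding incidence_vector_eq[of C] min_even_def by simp
  have indep: "\<not> F2.dependent (incidence_vector ` ?S)"
  proof -
    obtain H where H: "two_tree H" "subgraph G H" using assms unfolding partial_two_tree_def by blast
    have "F2_indep {C. short_in (edges G) W C}"
      using indep_short_two_tree[OF H(1)] H(2) by (simp add: subgraph_def)
    then have "\<not> F2.dependent (ind ` {C. short_in (edges G) W C})" by (rule independent_ind)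
    moreover have "incidence_vector ` ?S \<subseteq> ind ` {C. short_in (edges G) W C}"
      using lex_short_imp_short_in by (auto simp: incidence_vector_eq)
    ultimately show ?thesis using F2.dependent_mono by blast
  qed
  have spanS: "F2.span (incidence_vector ` ?S) = F2.span (incidence_vector ` ?cyc)"
  proof (rule subset_antisym)
    show "F2.span (incidence_vector ` ?S) \<subseteq> F2.span (incidence_vector ` ?cyc)"
      using S by (intro F2.span_mono) auto
    have "incidence_vector C \<in> F2.span (incidence_vector ` ?S)" if "is_cycle G C" for C
      by (rule subsetD[OF F2.span_mono cyc_span[OF that]]) auto
    then show "F2.span (incidence_vector ` ?cyc) \<subseteq> F2.span (incidence_vector ` ?S)"
      by (intro F2.span_minimal) auto
  qed
  have spanning: "spanning_cycles G ?S"
    using S spanS unfolding spanning_cycles_def cycle_space_def span_F2_def by simp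
  have card_le: "card ?S \<le> card B" if B: "spanning_cycles G B" for B
  proof -
    have Bc: "B \<subseteq> ?cyc" and Bs: "F2.span (incidence_vector ` B) = F2.span (incidence_vector ` ?cyc)"
      using B unfolding spanning_cycles_def cycle_space_def span_F2_def by auto
    have "incidence_vector ` ?S \<subseteq> F2.span (incidence_vector ` B)"
      unfolding Bs spanS[symmetric] by (rule F2.span_superset)
    \<comment> \<open>Steinitz: an independent set inside the span of a finite set is no larger than
      that set.\<close>
    then have "card (incidence_vector ` ?S) \<le> card (incidence_vector ` B)"
      using F2.independent_span_bound[OF _ indep] fin[OF Bc] by blast
    then show ?thesis using card_image[OF inj[OF S]] card_image[OF inj[OF Bc]] by simp
  qed
  have basis: "cycle_basis G ?S" using spanning card_le unfolding cycle_basis_def by blast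
  have "(\<Sum>C\<in>?S. weight w C) \<le> (\<Sum>C\<in>B. weight w C)" if B: "cycle_basis G B" for B
  proof (rule sum_le_if_card_le)
    have Bsp: "spanning_cycles G B" and Bmin: "\<And>B'. spanning_cycles G B' \<Longrightarrow> card B \<le> card B'"
      using B unfolding cycle_basis_def by auto
    have Bc: "B \<subseteq> ?cyc" using Bsp unfolding spanning_cycles_def by simp
    show "finite ?S" "finite B" using fin S Bc by blast+
    show "card ?S = card B" using card_le[OF Bsp] Bmin[OF spanning] by simp
    \<comment> \<open>A member in the span of the others could be dropped, leaving a smaller
      spanning set of cycles.\<close>
    have indB: "\<not> F2.dependent (incidence_vector ` B)"
    proof
      assume "F2.dependent (incidence_vector ` B)"
      then obtain C where C: "C \<in> B"
        "incidence_vector C \<in> F2.span (incidence_vector ` B - {incidence_vector C})"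
        unfolding F2.dependent_def by blast
      have "incidence_vector ` B - {incidence_vector C} = incidence_vector ` (B - {C})"
        using inj_on_image_set_diff[OF inj[OF Bc], of B "{C}"] C(1) by simp
      then have "F2.span (incidence_vector ` (B - {C})) =
          F2.span (insert (incidence_vector C) (incidence_vector ` (B - {C})))"
        using F2.span_redundant C(2) by metis
      also have "insert (incidence_vector C) (incidence_vector ` (B - {C})) = incidence_vector ` B"
        using C(1) by auto
      finally have "spanning_cycles G (B - {C})"
        using Bsp unfolding spanning_cycles_def span_F2_def by blast
      then have "card B \<le> card (B - {C})" by (rule Bmin)
      then show False using C(1) fin[OF Bc] by (metis card_Diff1_less not_le)
    qed
    fix t
    let ?Bt = "{C\<in>B. weight w C \<le> t}" and ?St = "{C\<in>?S. weight w C \<le> t}"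
    have "\<not> F2.dependent (incidence_vector ` ?Bt)"
      using F2.dependent_mono[of "incidence_vector ` ?Bt" "incidence_vector ` B"] indB by blast
    moreover have "incidence_vector ` ?Bt \<subseteq> F2.span (incidence_vector ` ?St)"
    proof
      fix v assume "v \<in> incidence_vector ` ?Bt"
      then obtain C where C: "C \<in> B" "weight w C \<le> t" "v = incidence_vector C" by blast
      have cC: "is_cycle G C" using C Bc by auto
      \<comment> \<open>\<open>w\<close> is the leading criterion in \<open>W\<close>, so a cycle
        that is no heavier for \<open>W\<close> is no heavier for \<open>w\<close>.\<close>
      have "weight w C' \<le> weight w C"
        if "lex_short_cycle G w r C'" "sum W (edges C') \<le> sum W (edges C)" for C'
      proof -
        have "is_cycle G C'" using that S by auto
        then show ?thesis
          using W_less[OF cycle_props(1)[OF cC] cycle_props(1)] that(2) unfolding weight_def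
          by (meson not_le)
      qed
      then have "{C'. lex_short_cycle G w r C' \<and> sum W (edges C') \<le> sum W (edges C)} \<subseteq> ?St"
        using C(2) by fastforce
      then show "v \<in> F2.span (incidence_vector ` ?St)"
        unfolding C(3) using cyc_span[OF cC] F2.span_mono[OF image_mono] by blast
    qed
    moreover have "?St \<subseteq> ?cyc" "?Bt \<subseteq> ?cyc" using S Bc by auto
    ultimately have "card (incidence_vector ` ?Bt) \<le> card (incidence_vector ` ?St)"
      using F2.independent_span_bound[OF finite_imageI[OF fin]] by blast
    then show "card ?Bt \<le> card ?St"
      using card_image[OF inj[OF \<open>?St \<subseteq> ?cyc\<close>]] card_image[OF inj[OF \<open>?Bt \<subseteq> ?cyc\<close>]] by simp
  qed
  then show ?thesis using basis unfolding minimum_cycle_basis_def by blast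
qed

end

theorem theorem2:
  fixes G :: "'a ugraph"
    and w :: "'a set \<Rightarrow> nat"
    and r :: "'a rel"
  assumes "simple_graph G"
    and "finite (verts G)"
    and "connected_graph G"
    and "partial_two_tree G"
    and "linear_order_on (verts G) r"
  shows "minimum_cycle_basis G w {C. lex_short_cycle G w r C}"
proof -
  have "edges G \<subseteq> Pow (verts G)" using assms(1) unfolding simple_graph_def by blast
  then have "finite (edges G)" using assms(2) finite_subset by blast
  then show ?thesis
  \<comment> \<open>The tie-breaker \<open>g\<close> gives each edge the codes of its two ends, so
    that along paths it reflects the vertex sets.\<close>
  proof (rule lex_weight_exists[where w = w and g = "sum (vertex_code r (verts G))"])
    fix W :: "'a set \<Rightarrow> nat"
    assume "\<And>e. e \<in> edges G \<Longrightarrow> W e > 0"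
      and "\<And>Z Z'. Z \<subseteq> edges G \<Longrightarrow> Z' \<subseteq> edges G \<Longrightarrow> sum W Z < sum W Z' \<longleftrightarrow>
        sum w Z < sum w Z' \<or> sum w Z = sum w Z' \<and> (card Z < card Z' \<or> card Z = card Z' \<and>
          (\<Sum>e\<in>Z'. sum (vertex_code r (verts G)) e) < (\<Sum>e\<in>Z. sum (vertex_code r (verts G)) e))"
    then have "lex_weighted G w r W"
      by (rule lex_weighted.intro[OF assms(1,2,5)])
    then show ?thesis using assms(4) by (rule lex_weighted.lex_short_minimum_cycle_basis)
  qed
qed

end
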